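(* Let $f\in(F_n^\infty)^*+F_n^\infty$ and let $u=P[f]$ be its noncommutative Poisson transform. Then $u$ is a free pluriharmonic function on $[B(\mathcal{H})^n]_1$, where $\mathcal{H}$ is a Hilbert space. Moreover, $u\ge0$ on $[B(\mathcal{H})^n]_1$, where $\mathcal{H}$ is an infinite dimensional Hilbert space, if and only if $f\ge0$.
   Context: $\mathbb{F}_n^+$ is the unital free semigroup on generators $g_1,\ldots,g_n$ with identity $g_0$; $|\alpha|$ is word length; $X_\alpha:=X_{i_1}\cdots X_{i_k}$ if $\alpha=g_{i_1}\cdots g_{i_k}$, $X_{g_0}:=I$. $[B(\mathcal{H})^n]_1$ is the set of $[X_1,\ldots,X_n]\in B(\mathcal{H})^n$ with $\|\sum_iX_iX_i^*\|<1$. $F^2(H_n)=\mathbb{C}1\oplus\bigoplus_{m\ge1}H_n^{\otimes m}$ is the full Fock space, $H_n$ an $n$-dimensional Hilbert space with orthonormal basis $e_1,\ldots,e_n$; $e_\alpha:=e_{i_1}\otimes\cdots\otimes e_{i_k}$, $e_{g_0}:=1$. $F_n^\infty$ is the set of $g=\sum a_\alpha e_\alpha\in F^2(H_n)$ for which left multiplication $L_g:h\mapsto g\otimes h$ (with $e_\alpha\otimes e_\beta=e_{\alpha\beta}$) is a bounded operator on $F^2(H_n)$, identified with the algebra $\{L_g\}\subset B(F^2(H_n))$; $(F_n^\infty)^*+F_n^\infty:=\{L_h^*+L_g: h,g\in F_n^\infty\}$. $f\ge0$ means $f$ is a positive operator on $F^2(H_n)$; $u\ge0$ means $u(X)\ge0$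 for all $X\in[B(\mathcal{H})^n]_1$. Noncommutative Poisson transform: for $X=[X_1,\ldots,X_n]\in[B(\mathcal{H})^n]_1$ let $\Delta_X:=(I-\sum_iX_iX_i^* )^{1/2}$ and $K_X:\mathcal{H}\to F^2(H_n)\otimes\mathcal{H}$, $K_Xh:=\sum_{\alpha\in\mathbb{F}_n^+}e_\alpha\otimes\Delta_XX_\alpha^*h$. For $A\in B(F^2(H_n))$, $P[A](X):=K_X^*(A\otimes I_{\mathcal{H}})K_X$. A free holomorphic function on $[B(\mathcal{H})^n]_1$ is $F(X)=\sum_{k=0}^\infty\sum_{|\alpha|=k}a_\alpha X_\alpha$ with $a_\alpha\in\mathbb{C}$, $\limsup_{k\to\infty}(\sum_{|\alpha|=k}|a_\alpha|^2)^{1/2k}\le1$. A self-adjoint free pluriharmonic function is $G(X)=\frac12(F(X)+F(X)^* )$ with $F$ free holomorphic; a free pluriharmonic function is $H_1+iH_2$ with $H_1,H_2$ self-adjoint free pluriharmonic. *)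

theory Defs
  imports "HOL-Analysis.Analysis"
begin

section \<open>Complex Hilbert spaces\<close>

text \<open>
  A complex inner product space is presented as a real inner product space together with a
  compatible complex scalar multiplication and a complex inner product (linear in the first
  argument) whose real part is the given real one. In particular the norm, topology and
  completeness are those of the complex inner product.
\<close>

class complex_vector = real_vector +
  fixes scaleC :: "complex \<Rightarrow> 'a \<Rightarrow> 'a" (infixr "*\<^sub>C" 75)
  assumes scaleC_add_right: "c *\<^sub>C (x + y) = c *\<^sub>C x + c *\<^sub>C y"
    and scaleC_add_left: "(c + d) *\<^sub>C x = c *\<^sub>C x + d *\<^sub>C x"
    and scaleC_scaleC: "c *\<^sub>C d *\<^sub>C x = (c * d) *\<^sub>C x"
    and scaleC_of_real: "complex_of_real r *\<^sub>C x = r *\<^sub>R x"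

class complex_inner = real_inner + complex_vector +
  fixes cinner :: "'a \<Rightarrow> 'a \<Rightarrow> complex"
  assumes cinner_commute: "cinner x y = cnj (cinner y x)"
    and cinner_add_left: "cinner (x + y) z = cinner x z + cinner y z"
    and cinner_scaleC_left: "cinner (c *\<^sub>C x) y = c * cinner x y"
    and Re_cinner: "Re (cinner x y) = inner x y"

class chilbert_space = complex_inner + complete_space

lemma scaleC_one: "1 *\<^sub>C x = (x::'a::complex_vector)"
  using scaleC_of_real[of 1 x] by simp

interpretation complex_vector: vector_space "scaleC :: complex \<Rightarrow> 'a \<Rightarrow> 'a::complex_vector"
  by unfold_locales (simp_all add: scaleC_add_right scaleC_add_left scaleC_scaleC scaleC_one)

definition infinite_dimensional :: "'a::complex_vector itself \<Rightarrow> bool" where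
  "infinite_dimensional _ \<longleftrightarrow> \<not> (\<exists>B::'a set. finite B \<and> complex_vector.span B = UNIV)"

lemma cinner_scaleC_right: "cinner x (c *\<^sub>C y) = cnj c * cinner x (y::'a::complex_inner)"
  by (metis cinner_commute cinner_scaleC_left complex_cnj_mult)

lemma norm_scaleC: "norm (c *\<^sub>C x) = cmod c * norm (x::'a::complex_inner)"
proof -
  have "inner (c *\<^sub>C x) (c *\<^sub>C x) = Re ((c * cnj c) * cinner x x)"
    by (simp add: Re_cinner[symmetric] cinner_scaleC_left cinner_scaleC_right mult.assoc
        mult.left_commute)
  also have "\<dots> = (cmod c)\<^sup>2 * inner x x"
    by (simp only: complex_norm_square[symmetric] Re_complex_of_real Re_cinner[symmetric])
       (simp flip: of_real_power)
  finally show ?thesis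
    by (simp add: norm_eq_sqrt_inner real_sqrt_mult)
qed

lemma bounded_linear_scaleC: "bounded_linear (\<lambda>x::'a::complex_inner. c *\<^sub>C x)"
proof (rule bounded_linear_intro[where K = "cmod c"])
  fix r :: real and x :: 'a
  show "c *\<^sub>C r *\<^sub>R x = r *\<^sub>R c *\<^sub>C x"
    by (simp only: scaleC_of_real[symmetric] scaleC_scaleC mult.commute)
qed (simp_all add: scaleC_add_right norm_scaleC)

lemma cinner_eq: "cinner x y = Complex (inner x y) (inner (- \<i> *\<^sub>C x) (y::'a::complex_inner))"
  by (rule complex_eqI) (simp_all add: Re_cinner[symmetric] cinner_scaleC_left del: complex_vector.scale_minus_left)

lemma norm_cinner_le: "cmod (cinner x y) \<le> 2 * (norm x * norm (y::'a::complex_inner))"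
proof -
  have "cmod (cinner x y) \<le> \<bar>Re (cinner x y)\<bar> + \<bar>Im (cinner x y)\<bar>"
    by (rule cmod_le)
  also have "\<dots> = \<bar>inner x y\<bar> + \<bar>inner (- \<i> *\<^sub>C x) y\<bar>"
    using arg_cong[OF cinner_eq, of Re x y] arg_cong[OF cinner_eq, of Im x y]
    by (simp only: complex.sel)
  also have "\<dots> \<le> norm x * norm y + norm (- \<i> *\<^sub>C x) * norm y"
    by (intro add_mono Cauchy_Schwarz_ineq2)
  finally show ?thesis
    by (simp add: norm_scaleC del: complex_vector.scale_minus_left)
qed

instantiation complex :: chilbert_space
begin
definition scaleC_complex :: "complex \<Rightarrow> complex \<Rightarrow> complex" where "scaleC_complex c x = c * x"
definition cinner_complex :: "complex \<Rightarrow> complex \<Rightarrow> complex" where "cinner_complex x y = x * cnj y"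
instance
  by standard (simp_all add: scaleC_complex_def cinner_complex_def inner_complex_def
      algebra_simps scaleR_conv_of_real)
end

section \<open>Bounded operators\<close>

text \<open>
  The type of bounded \<^emph>\<open>real\<close>-linear maps, with its operator norm, is taken from the library;
  \<open>bops\<close> singles out the complex-linear ones, i.e. the space of bounded operators.
\<close>

definition bops :: "('a::complex_inner \<Rightarrow>\<^sub>L 'b::complex_inner) set" where
  "bops = {T. \<forall>c x. blinfun_apply T (c *\<^sub>C x) = c *\<^sub>C blinfun_apply T x}"

instantiation blinfun :: (real_normed_vector, complex_inner) complex_vector
begin
lift_definition scaleC_blinfun :: "complex \<Rightarrow> 'a \<Rightarrow>\<^sub>L 'b \<Rightarrow> 'a \<Rightarrow>\<^sub>L 'b"
  is "\<lambda>c T x. c *\<^sub>C T x"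
  by (rule bounded_linear_compose[OF bounded_linear_scaleC])
instance
  by standard (transfer; simp add: scaleC_add_right scaleC_add_left scaleC_scaleC scaleC_of_real)+
end

text \<open>
  On Hilbert spaces, the defining conditions of \<open>adj\<close> and \<open>sqrt_op\<close> are met by exactly one operator
  when the argument is complex-linear, respectively positive.
\<close>

definition adj :: "('a::complex_inner \<Rightarrow>\<^sub>L 'b::complex_inner) \<Rightarrow> ('b \<Rightarrow>\<^sub>L 'a)" where
  "adj T = (THE S. \<forall>x y. cinner (blinfun_apply T x) y = cinner x (blinfun_apply S y))"

definition positive_op :: "('a::complex_inner \<Rightarrow>\<^sub>L 'a) \<Rightarrow> bool" where
  "positive_op T \<longleftrightarrow> T \<in> bops \<and> (\<forall>x. cinner (blinfun_apply T x) x \<in> \<real>\<^sub>\<ge>\<^sub>0)"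

definition sqrt_op :: "('a::complex_inner \<Rightarrow>\<^sub>L 'a) \<Rightarrow> ('a \<Rightarrow>\<^sub>L 'a)" where
  "sqrt_op T = (THE S. positive_op S \<and> S o\<^sub>L S = T)"

section \<open>Square-summable families and Hilbert space tensor products\<close>

typedef (overloaded) ('i, 'h) ell2 =
  "{f :: 'i \<Rightarrow> 'h::complex_inner. (\<lambda>i. (norm (f i))\<^sup>2) summable_on UNIV}"
  by (rule exI[of _ "\<lambda>_. 0"]) simp

setup_lifting type_definition_ell2

lemma ell2_prod_summable:
  fixes f g :: "'i \<Rightarrow> 'h::real_normed_vector"
  assumes "(\<lambda>i. (norm (f i))\<^sup>2) summable_on UNIV" "(\<lambda>i. (norm (g i))\<^sup>2) summable_on UNIV"
  shows "(\<lambda>i. norm (f i) * norm (g i)) summable_on UNIV"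
proof (rule summable_on_comparison_test)
  show "(\<lambda>i. (norm (f i))\<^sup>2 + (norm (g i))\<^sup>2) summable_on UNIV"
    by (rule summable_on_add[OF assms])
  show "norm (f i) * norm (g i) \<le> (norm (f i))\<^sup>2 + (norm (g i))\<^sup>2" for i
    using sum_squares_bound[of "norm (f i)" "norm (g i)"]
      mult_nonneg_nonneg[OF norm_ge_zero norm_ge_zero, of "f i" "g i"] by linarith
qed simp

lemma ell2_add_summable:
  fixes f g :: "'i \<Rightarrow> 'h::real_normed_vector"
  assumes "(\<lambda>i. (norm (f i))\<^sup>2) summable_on UNIV" "(\<lambda>i. (norm (g i))\<^sup>2) summable_on UNIV"
  shows "(\<lambda>i. (norm (f i + g i))\<^sup>2) summable_on UNIV"
proof (rule summable_on_comparison_test)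
  show "(\<lambda>i. (norm (f i))\<^sup>2 + 2 * (norm (f i) * norm (g i)) + (norm (g i))\<^sup>2) summable_on UNIV"
    by (intro summable_on_add summable_on_cmult_right assms ell2_prod_summable)
  show "(norm (f i + g i))\<^sup>2 \<le> (norm (f i))\<^sup>2 + 2 * (norm (f i) * norm (g i)) + (norm (g i))\<^sup>2" for i
    using power_mono[OF norm_triangle_ineq norm_ge_zero, of "f i" "g i" 2]
    by (simp add: power2_sum)
qed simp

lemma ell2_scaleR_summable:
  fixes f :: "'i \<Rightarrow> 'h::real_normed_vector"
  assumes "(\<lambda>i. (norm (f i))\<^sup>2) summable_on UNIV"
  shows "(\<lambda>i. (norm (r *\<^sub>R f i))\<^sup>2) summable_on UNIV"
  using summable_on_cmult_right[OF assms, of "\<bar>r\<bar>\<^sup>2"] by (simp add: power_mult_distrib)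

lemma ell2_inner_summable:
  fixes f g :: "'i \<Rightarrow> 'h::real_inner"
  assumes "(\<lambda>i. (norm (f i))\<^sup>2) summable_on UNIV" "(\<lambda>i. (norm (g i))\<^sup>2) summable_on UNIV"
  shows "(\<lambda>i. inner (f i) (g i)) summable_on UNIV"
proof (rule abs_summable_summable, rule summable_on_comparison_test)
  show "(\<lambda>i. norm (f i) * norm (g i)) summable_on UNIV"
    by (rule ell2_prod_summable[OF assms])
qed (simp_all add: Cauchy_Schwarz_ineq2)

lemma ell2_cinner_summable:
  fixes f g :: "'i \<Rightarrow> 'h::complex_inner"
  assumes "(\<lambda>i. (norm (f i))\<^sup>2) summable_on UNIV" "(\<lambda>i. (norm (g i))\<^sup>2) summable_on UNIV"
  shows "(\<lambda>i. cinner (f i) (g i)) summable_on UNIV"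
proof (rule abs_summable_summable, rule summable_on_comparison_test)
  show "(\<lambda>i. 2 * (norm (f i) * norm (g i))) summable_on UNIV"
    by (intro summable_on_cmult_right ell2_prod_summable assms)
qed (simp_all add: norm_cinner_le)

instantiation ell2 :: (type, complex_inner) complex_inner
begin

lift_definition zero_ell2 :: "('a, 'b) ell2" is "\<lambda>_. 0"
  by simp

lift_definition plus_ell2 :: "('a, 'b) ell2 \<Rightarrow> ('a, 'b) ell2 \<Rightarrow> ('a, 'b) ell2"
  is "\<lambda>f g i. f i + g i"
  by (rule ell2_add_summable)

lift_definition uminus_ell2 :: "('a, 'b) ell2 \<Rightarrow> ('a, 'b) ell2" is "\<lambda>f i. - f i"
  by simp

lift_definition minus_ell2 :: "('a, 'b) ell2 \<Rightarrow> ('a, 'b) ell2 \<Rightarrow> ('a, 'b) ell2"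
  is "\<lambda>f g i. f i - g i"
proof -
  fix f g :: "'a \<Rightarrow> 'b"
  assume "(\<lambda>i. (norm (f i))\<^sup>2) summable_on UNIV" "(\<lambda>i. (norm (g i))\<^sup>2) summable_on UNIV"
  then show "(\<lambda>i. (norm (f i - g i))\<^sup>2) summable_on UNIV"
    using ell2_add_summable[of f "\<lambda>i. - g i"] by simp
qed

lift_definition scaleR_ell2 :: "real \<Rightarrow> ('a, 'b) ell2 \<Rightarrow> ('a, 'b) ell2" is "\<lambda>r f i. r *\<^sub>R f i"
  by (rule ell2_scaleR_summable)

lift_definition scaleC_ell2 :: "complex \<Rightarrow> ('a, 'b) ell2 \<Rightarrow> ('a, 'b) ell2" is "\<lambda>c f i. c *\<^sub>C f i"
proof -
  fix c :: complex and f :: "'a \<Rightarrow> 'b"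
  assume "(\<lambda>i. (norm (f i))\<^sup>2) summable_on UNIV"
  then show "(\<lambda>i. (norm (c *\<^sub>C f i))\<^sup>2) summable_on UNIV"
    using summable_on_cmult_right[of "\<lambda>i. (norm (f i))\<^sup>2" UNIV "(cmod c)\<^sup>2"]
    by (simp add: norm_scaleC power_mult_distrib)
qed

lift_definition inner_ell2 :: "('a, 'b) ell2 \<Rightarrow> ('a, 'b) ell2 \<Rightarrow> real"
  is "\<lambda>f g. \<Sum>\<^sub>\<infinity>i. inner (f i) (g i)" .

lift_definition cinner_ell2 :: "('a, 'b) ell2 \<Rightarrow> ('a, 'b) ell2 \<Rightarrow> complex"
  is "\<lambda>f g. \<Sum>\<^sub>\<infinity>i. cinner (f i) (g i)" .

definition norm_ell2 :: "('a, 'b) ell2 \<Rightarrow> real" where "norm_ell2 x = sqrt (inner x x)"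
definition dist_ell2 :: "('a, 'b) ell2 \<Rightarrow> ('a, 'b) ell2 \<Rightarrow> real" where "dist_ell2 x y = norm (x - y)"
definition sgn_ell2 :: "('a, 'b) ell2 \<Rightarrow> ('a, 'b) ell2" where "sgn_ell2 x = inverse (norm x) *\<^sub>R x"
definition uniformity_ell2 :: "(('a, 'b) ell2 \<times> ('a, 'b) ell2) filter" where
  "uniformity_ell2 = (INF e\<in>{0<..}. principal {(x, y). dist x y < e})"
definition open_ell2 :: "('a, 'b) ell2 set \<Rightarrow> bool" where
  "open_ell2 U \<longleftrightarrow> (\<forall>x\<in>U. eventually (\<lambda>(x', y). x' = x \<longrightarrow> y \<in> U) uniformity)"

instance
proof
  fix x y z :: "('a, 'b) ell2" and r s :: real and c d :: complex
  show "x + y + z = x + (y + z)" by transfer (simp add: add.assoc)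
  show "x + y = y + x" by transfer (simp add: add.commute)
  show "0 + x = x" by transfer simp
  show "- x + x = 0" by transfer simp
  show "x - y = x + - y" by transfer simp
  show "r *\<^sub>R (x + y) = r *\<^sub>R x + r *\<^sub>R y" by transfer (simp add: scaleR_add_right)
  show "(r + s) *\<^sub>R x = r *\<^sub>R x + s *\<^sub>R x" by transfer (simp add: scaleR_add_left)
  show "r *\<^sub>R s *\<^sub>R x = (r * s) *\<^sub>R x" by transfer simp
  show "1 *\<^sub>R x = x" by transfer simp
  show "c *\<^sub>C (x + y) = c *\<^sub>C x + c *\<^sub>C y" by transfer (simp add: scaleC_add_right)
  show "(c + d) *\<^sub>C x = c *\<^sub>C x + d *\<^sub>C x" by transfer (simp add: scaleC_add_left)
  show "c *\<^sub>C d *\<^sub>C x = (c * d) *\<^sub>C x" by transfer (simp add: scaleC_scaleC)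
  show "complex_of_real r *\<^sub>C x = r *\<^sub>R x" by transfer (simp add: scaleC_of_real)
  show "dist x y = norm (x - y)" by (rule dist_ell2_def)
  show "sgn x = inverse (norm x) *\<^sub>R x" by (rule sgn_ell2_def)
  show "uniformity = (INF e\<in>{0<..}. principal {(x::('a, 'b) ell2, y). dist x y < e})"
    by (rule uniformity_ell2_def)
  show "open U = (\<forall>x\<in>U. eventually (\<lambda>(x', y). x' = x \<longrightarrow> y \<in> U) uniformity)"
    for U :: "('a, 'b) ell2 set" by (rule open_ell2_def)
  show "norm x = sqrt (inner x x)" by (rule norm_ell2_def)
  show "inner x y = inner y x" by transfer (simp add: inner_commute)
  show "inner (x + y) z = inner x z + inner y z"
    by transfer (simp add: inner_add_left infsum_add ell2_inner_summable)
  show "inner (r *\<^sub>R x) y = r * inner x y"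
    by transfer (simp add: infsum_cmult_right')
  show "0 \<le> inner x x" by transfer (simp add: infsum_nonneg)
  show "inner x x = 0 \<longleftrightarrow> x = 0"
  proof transfer
    fix f :: "'a \<Rightarrow> 'b"
    assume f: "(\<lambda>i. (norm (f i))\<^sup>2) summable_on UNIV"
    show "(\<Sum>\<^sub>\<infinity>i. inner (f i) (f i)) = 0 \<longleftrightarrow> f = (\<lambda>_. 0)"
    proof
      assume "(\<Sum>\<^sub>\<infinity>i. inner (f i) (f i)) = 0"
      then have "inner (f i) (f i) = 0" for i
        using nonneg_infsum_le_0D[of "\<lambda>i. inner (f i) (f i)" UNIV i] ell2_inner_summable[OF f f]
        by simp
      then show "f = (\<lambda>_. 0)" by auto
    qed simp
  qed
  show "cinner x y = cnj (cinner y x)"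
    by transfer (simp flip: infsum_cnj add: cinner_commute[symmetric])
  show "cinner (x + y) z = cinner x z + cinner y z"
    by transfer (simp add: cinner_add_left infsum_add ell2_cinner_summable)
  show "cinner (c *\<^sub>C x) y = c * cinner x y"
    by transfer (simp add: cinner_scaleC_left infsum_cmult_right')
  show "Re (cinner x y) = inner x y"
    by transfer (simp add: Re_cinner ell2_cinner_summable flip: infsum_Re)
qed

end

lemma norm_ell2_square: "(norm x)\<^sup>2 = (\<Sum>\<^sub>\<infinity>i. (norm (Rep_ell2 x i))\<^sup>2)"
  by (simp add: power2_norm_eq_inner inner_ell2.rep_eq)

lemma sum_Rep_ell2_le: "finite F \<Longrightarrow> (\<Sum>i\<in>F. (norm (Rep_ell2 x i))\<^sup>2) \<le> (norm x)\<^sup>2"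
  unfolding norm_ell2_square using Rep_ell2[of x] by (intro finite_sum_le_infsum) auto

lemma norm_Rep_ell2_le: "norm (Rep_ell2 x i) \<le> norm x"
  using sum_Rep_ell2_le[of "{i}" x] by (simp add: power2_le_iff_abs_le)

instance ell2 :: (type, chilbert_space) chilbert_space
proof
  fix X :: "nat \<Rightarrow> ('a, 'b) ell2"
  assume X: "Cauchy X"
  have "Cauchy (\<lambda>n. Rep_ell2 (X n) i)" for i
  proof (rule metric_CauchyI)
    fix e :: real
    assume "e > 0"
    then obtain M where M: "\<And>m n. m \<ge> M \<Longrightarrow> n \<ge> M \<Longrightarrow> dist (X m) (X n) < e"
      using metric_CauchyD[OF X] by blast
    have "dist (Rep_ell2 (X m) i) (Rep_ell2 (X n) i) < e" if "m \<ge> M" "n \<ge> M" for m n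
      using M[OF that] norm_Rep_ell2_le[of "X m - X n" i] by (simp add: dist_norm minus_ell2.rep_eq)
    then show "\<exists>M. \<forall>m\<ge>M. \<forall>n\<ge>M. dist (Rep_ell2 (X m) i) (Rep_ell2 (X n) i) < e" by blast
  qed
  then have "\<forall>i. \<exists>l. (\<lambda>n. Rep_ell2 (X n) i) \<longlonglongrightarrow> l"
    by (simp add: Cauchy_convergent_iff convergent_def)
  then obtain f where f: "\<And>i. (\<lambda>n. Rep_ell2 (X n) i) \<longlonglongrightarrow> f i" by metis
  have bound: "(\<Sum>i\<in>F. (norm (Rep_ell2 (X m) i - f i))\<^sup>2) \<le> e\<^sup>2"
    if M: "\<And>m n. m \<ge> M \<Longrightarrow> n \<ge> M \<Longrightarrow> dist (X m) (X n) < e" and "finite F" "m \<ge> M" for e M m F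
  proof (rule LIMSEQ_le_const2)
    show "(\<lambda>n. \<Sum>i\<in>F. (norm (Rep_ell2 (X m) i - Rep_ell2 (X n) i))\<^sup>2)
        \<longlonglongrightarrow> (\<Sum>i\<in>F. (norm (Rep_ell2 (X m) i - f i))\<^sup>2)"
      by (intro tendsto_intros f)
    show "\<exists>N. \<forall>n\<ge>N. (\<Sum>i\<in>F. (norm (Rep_ell2 (X m) i - Rep_ell2 (X n) i))\<^sup>2) \<le> e\<^sup>2"
    proof (intro exI allI impI)
      fix n assume "n \<ge> M"
      have "(\<Sum>i\<in>F. (norm (Rep_ell2 (X m) i - Rep_ell2 (X n) i))\<^sup>2) \<le> (norm (X m - X n))\<^sup>2"
        using sum_Rep_ell2_le[OF \<open>finite F\<close>, of "X m - X n"] by (simp add: minus_ell2.rep_eq)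
      also have "\<dots> \<le> e\<^sup>2"
        using M[OF \<open>m \<ge> M\<close> \<open>n \<ge> M\<close>] by (intro power_mono) (simp_all add: dist_norm)
      finally show "(\<Sum>i\<in>F. (norm (Rep_ell2 (X m) i - Rep_ell2 (X n) i))\<^sup>2) \<le> e\<^sup>2" .
    qed
  qed
  have sq: "(\<lambda>i. (norm (Rep_ell2 (X m) i - f i))\<^sup>2) summable_on UNIV"
    if "\<And>m n. m \<ge> M \<Longrightarrow> n \<ge> M \<Longrightarrow> dist (X m) (X n) < e" "m \<ge> M" for e M m
    by (rule nonneg_bdd_above_summable_on) (auto intro!: bdd_aboveI2 bound[OF that(1) _ that(2)])
  obtain M1 where M1: "\<And>m n. m \<ge> M1 \<Longrightarrow> n \<ge> M1 \<Longrightarrow> dist (X m) (X n) < 1"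
    using metric_CauchyD[OF X, of 1] by auto
  have "(\<lambda>i. (norm (- (Rep_ell2 (X M1) i - f i)))\<^sup>2) summable_on UNIV"
    using sq[OF M1, of M1] by (simp only: norm_minus_cancel order.refl)
  from ell2_add_summable[OF _ this, of "Rep_ell2 (X M1)"]
  have fs: "(\<lambda>i. (norm (f i))\<^sup>2) summable_on UNIV"
    using Rep_ell2[of "X M1"] by simp
  have "X \<longlonglongrightarrow> Abs_ell2 f"
  proof (rule metric_LIMSEQ_I)
    fix e :: real
    assume "e > 0"
    then obtain M where M: "\<And>m n. m \<ge> M \<Longrightarrow> n \<ge> M \<Longrightarrow> dist (X m) (X n) < e / 2"
      using metric_CauchyD[OF X, of "e / 2"] by auto
    have "dist (X m) (Abs_ell2 f) < e" if m: "m \<ge> M" for m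
    proof -
      have "(norm (X m - Abs_ell2 f))\<^sup>2 = (\<Sum>\<^sub>\<infinity>i. (norm (Rep_ell2 (X m) i - f i))\<^sup>2)"
        using fs by (simp add: norm_ell2_square minus_ell2.rep_eq Abs_ell2_inverse)
      also have "\<dots> \<le> (e / 2)\<^sup>2"
        by (rule infsum_le_finite_sums[OF sq[OF M m]]) (auto intro: bound[OF M _ m])
      finally have "norm (X m - Abs_ell2 f) \<le> e / 2"
        using \<open>e > 0\<close> by (simp add: power2_le_iff_abs_le)
      then show ?thesis using \<open>e > 0\<close> by (simp add: dist_norm)
    qed
    then show "\<exists>M. \<forall>m\<ge>M. dist (X m) (Abs_ell2 f) < e" by blast
  qed
  then show "convergent X" by (auto simp: convergent_def)
qed

text \<open>
  The Hilbert space tensor product of \<open>('i, complex) ell2\<close> and \<open>'h\<close> is realised as the space of square-summable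
  families in \<open>'h\<close>, with the elementary tensors below.
\<close>

lift_definition ell2_tensor :: "('i, complex) ell2 \<Rightarrow> 'h \<Rightarrow> ('i, 'h::complex_inner) ell2"
    (infixr "\<otimes>\<^sub>2" 70)
  is "\<lambda>f h i. f i *\<^sub>C h"
proof -
  fix f :: "'i \<Rightarrow> complex" and h :: 'h
  assume "(\<lambda>i. (norm (f i))\<^sup>2) summable_on UNIV"
  then show "(\<lambda>i. (norm (f i *\<^sub>C h))\<^sup>2) summable_on UNIV"
    using summable_on_cmult_left[of "\<lambda>i. (norm (f i))\<^sup>2" UNIV "(norm h)\<^sup>2"]
    by (simp add: norm_scaleC power_mult_distrib)
qed

lemma cinner_ell2_tensor: "cinner (x \<otimes>\<^sub>2 h) (y \<otimes>\<^sub>2 k) = cinner x y * cinner h k"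
proof transfer
  fix x y :: "'i \<Rightarrow> complex" and h k :: "'h::complex_inner"
  show "(\<Sum>\<^sub>\<infinity>i. cinner (x i *\<^sub>C h) (y i *\<^sub>C k)) = (\<Sum>\<^sub>\<infinity>i. cinner (x i) (y i)) * cinner h k"
    by (subst infsum_cmult_left'[symmetric])
       (simp add: cinner_scaleC_left cinner_scaleC_right cinner_complex_def mult_ac)
qed

text \<open>
  For complex-linear \<open>A\<close>, the operator \<open>A \<otimes> I\<close>: it is unique since the elementary tensors span a
  dense subspace.
\<close>

definition tensor_id_op :: "(('i, complex) ell2 \<Rightarrow>\<^sub>L ('i, complex) ell2)
    \<Rightarrow> (('i, 'h::complex_inner) ell2 \<Rightarrow>\<^sub>L ('i, 'h) ell2)" where
  "tensor_id_op A = (THE T. \<forall>x h. blinfun_apply T (x \<otimes>\<^sub>2 h) = blinfun_apply A x \<otimes>\<^sub>2 h)"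

section \<open>The full Fock space and the noncommutative analytic Toeplitz algebra\<close>

text \<open>
  The generators are indexed by a finite type of \<open>n\<close> elements, the free semigroup consists of the
  lists over this type (product: concatenation, identity: the empty list), and the Fock space is
  given by coefficients with respect to its orthonormal basis of words: the words of length \<open>m\<close>
  span the summand of degree \<open>m\<close>.
\<close>

type_synonym 'n fock = "('n list, complex) ell2"

lift_definition fock_basis :: "'n list \<Rightarrow> 'n fock" is "\<lambda>\<alpha> \<beta>. if \<beta> = \<alpha> then 1 else 0"
proof -
  fix \<alpha> :: "'n list"
  show "(\<lambda>\<beta>. (norm (if \<beta> = \<alpha> then 1 else 0 :: complex))\<^sup>2) summable_on UNIV"
    by (rule finite_nonzero_values_imp_summable_on) (rule finite_subset[of _ "{\<alpha>}"], auto)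
qed

text \<open>Coefficients of the formal product: the sum runs over all factorisations of the word.\<close>

definition fock_mult_coeff :: "'n fock \<Rightarrow> 'n fock \<Rightarrow> 'n list \<Rightarrow> complex" where
  "fock_mult_coeff g h \<gamma> =
    (\<Sum>(\<alpha>, \<beta>) \<in> {(\<alpha>, \<beta>). \<alpha> @ \<beta> = \<gamma>}. Rep_ell2 g \<alpha> * Rep_ell2 h \<beta>)"

definition is_left_mult :: "'n fock \<Rightarrow> ('n fock \<Rightarrow>\<^sub>L 'n fock) \<Rightarrow> bool" where
  "is_left_mult g T \<longleftrightarrow> (\<forall>h. Rep_ell2 (blinfun_apply T h) = fock_mult_coeff g h)"

definition F_infinity :: "'n fock set" where
  "F_infinity = {g. \<exists>T. is_left_mult g T}"

definition left_mult :: "'n fock \<Rightarrow> ('n fock \<Rightarrow>\<^sub>L 'n fock)" where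
  "left_mult g = (THE T. is_left_mult g T)"

definition harmonic_symbols :: "('n fock \<Rightarrow>\<^sub>L 'n fock) set" where
  "harmonic_symbols = {adj (left_mult h) + left_mult g |h g. h \<in> F_infinity \<and> g \<in> F_infinity}"

section \<open>The noncommutative Poisson transform\<close>

fun word_op :: "('n \<Rightarrow> 'h::complex_inner \<Rightarrow>\<^sub>L 'h) \<Rightarrow> 'n list \<Rightarrow> 'h \<Rightarrow>\<^sub>L 'h" where
  "word_op X [] = id_blinfun"
| "word_op X (i # \<alpha>) = X i o\<^sub>L word_op X \<alpha>"

definition row_ball :: "('n::finite \<Rightarrow> 'h::complex_inner \<Rightarrow>\<^sub>L 'h) set" where
  "row_ball = {X. (\<forall>i. X i \<in> bops) \<and> norm (\<Sum>i\<in>UNIV. X i o\<^sub>L adj (X i)) < 1}"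

definition defect_op :: "('n::finite \<Rightarrow> 'h::complex_inner \<Rightarrow>\<^sub>L 'h) \<Rightarrow> 'h \<Rightarrow>\<^sub>L 'h" where
  "defect_op X = sqrt_op (id_blinfun - (\<Sum>i\<in>UNIV. X i o\<^sub>L adj (X i)))"

definition poisson_kernel ::
    "('n::finite \<Rightarrow> 'h::complex_inner \<Rightarrow>\<^sub>L 'h) \<Rightarrow> 'h \<Rightarrow>\<^sub>L ('n list, 'h) ell2" where
  "poisson_kernel X = Blinfun (\<lambda>h. \<Sum>\<^sub>\<infinity>\<alpha>.
     fock_basis \<alpha> \<otimes>\<^sub>2 blinfun_apply (defect_op X) (blinfun_apply (adj (word_op X \<alpha>)) h))"

definition poisson_transform ::
    "('n::finite fock \<Rightarrow>\<^sub>L 'n fock) \<Rightarrow> ('n \<Rightarrow> 'h::complex_inner \<Rightarrow>\<^sub>L 'h) \<Rightarrow> 'h \<Rightarrow>\<^sub>L 'h" where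
  "poisson_transform A X =
     adj (poisson_kernel X) o\<^sub>L tensor_id_op A o\<^sub>L poisson_kernel X"

section \<open>Free holomorphic and free pluriharmonic functions\<close>

text \<open>
  These are properties of the values on the open unit ball only. The series converges in the
  operator norm.
\<close>

definition free_holomorphic ::
    "(('n::finite \<Rightarrow> 'h::complex_inner \<Rightarrow>\<^sub>L 'h) \<Rightarrow> 'h \<Rightarrow>\<^sub>L 'h) \<Rightarrow> bool" where
  "free_holomorphic F \<longleftrightarrow> (\<exists>a :: 'n list \<Rightarrow> complex.
     limsup (\<lambda>k. ereal (root (2 * k) (\<Sum>\<alpha> | length \<alpha> = k. (cmod (a \<alpha>))\<^sup>2))) \<le> 1 \<and>
     (\<forall>X\<in>row_ball. (\<lambda>k. \<Sum>\<alpha> | length \<alpha> = k. a \<alpha> *\<^sub>C word_op X \<alpha>) sums F X))"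

definition sa_free_pluriharmonic ::
    "(('n::finite \<Rightarrow> 'h::complex_inner \<Rightarrow>\<^sub>L 'h) \<Rightarrow> 'h \<Rightarrow>\<^sub>L 'h) \<Rightarrow> bool" where
  "sa_free_pluriharmonic G \<longleftrightarrow>
     (\<exists>F. free_holomorphic F \<and> (\<forall>X\<in>row_ball. G X = (1 / 2) *\<^sub>R (F X + adj (F X))))"

definition free_pluriharmonic ::
    "(('n::finite \<Rightarrow> 'h::complex_inner \<Rightarrow>\<^sub>L 'h) \<Rightarrow> 'h \<Rightarrow>\<^sub>L 'h) \<Rightarrow> bool" where
  "free_pluriharmonic U \<longleftrightarrow> (\<exists>G H. sa_free_pluriharmonic G \<and> sa_free_pluriharmonic H \<and>
     (\<forall>X\<in>row_ball. U X = G X + \<i> *\<^sub>C H X))"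

end

theory Submission
  imports Defs
begin

text \<open>
  Let \<open>f = L\<^sub>h\<^sup>* + L\<^sub>g\<close>. The Poisson kernel \<open>K\<^sub>X\<close> is an isometry satisfying
  \<open>(K\<^sub>X y)(\<alpha>\<beta>) = (K\<^sub>X X\<^sub>\<alpha>\<^sup>* y)(\<beta>)\<close>, so a Fubini argument identifies \<open>P[L\<^sub>g](X)\<close> with the norm convergent
  series of the \<open>g\<^sub>\<alpha> X\<^sub>\<alpha>\<close>; hence \<open>P[f] = H\<^sup>* + G\<close> with \<open>G\<close>, \<open>H\<close> free holomorphic, and its real and
  imaginary parts come from \<open>G + H\<close> and \<open>- i (G - H)\<close>. Positivity passes from \<open>f\<close> to \<open>f \<otimes> I\<close> and to its
  compression \<open>P[f](X)\<close>. Conversely, an infinite dimensional space carries, for every \<open>m\<close>, a copy of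
  the left creation operators compressed to the words of length at most \<open>m\<close>. Evaluating \<open>P[f]\<close> at
  \<open>r < 1\<close> times this tuple and letting \<open>r\<close> tend to \<open>1\<close> recovers the quadratic form of \<open>f\<close> on finitely
  supported vectors.
\<close>

subsection \<open>Complex inner products\<close>

text \<open>\<open>adj\<close>, \<open>sqrt_op\<close> and \<open>tensor_id_op\<close> are definite
  descriptions, so existence and uniqueness come before any computation with the Poisson transform:
  they rest on Riesz representation, on a Banach fixed point, and on expanding finitely many vectors
  of the second tensor factor in an orthonormal family. The strict inequality defining the ball
  matters twice. It makes the words of length \<open>k\<close> decay geometrically, which yields
  both the isometry of the kernel and the absolute convergence behind the Fubini argument. It also
  excludes the truncated creation operators themselves, whose row has norm 1 once
  \<open>m > 0\<close>; hence the factor \<open>r\<close> and the limit. Truncation loses nothing: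
  the quadratic form at a vector supported on words of length at most \<open>m\<close> involves only
  words of length at most \<open>m\<close>. For a fixed vector it is therefore a polynomial in
  \<open>r\<close>, and the limit needs no uniform estimate. Infinite dimension supplies, for every
  \<open>m\<close>, an orthonormal family indexed by these words.\<close>

instance chilbert_space \<subseteq> banach ..

lemma cinner_add_right: "cinner x (y + z) = cinner x y + cinner x (z::'a::complex_inner)"
  by (metis cinner_add_left cinner_commute complex_cnj_add)

lemma cinner_self: "cinner x x = complex_of_real ((norm (x::'a::complex_inner))\<^sup>2)"
proof (rule complex_eqI)
  show "Im (cinner x x) = Im (complex_of_real ((norm x)\<^sup>2))"
    using arg_cong[OF cinner_commute[of x x], of Im] by simp
qed (simp add: Re_cinner power2_norm_eq_inner)

lemma cinner_Cauchy_Schwarz: "cmod (cinner x y) \<le> norm x * norm (y::'a::complex_inner)"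
proof (cases "cinner x y = 0")
  case False
  define c where "c = cnj (cinner x y) / cmod (cinner x y)"
  have c: "cmod c = 1" using False by (simp add: c_def norm_divide)
  have "cnj (cinner x y) * cinner x y = of_real ((cmod (cinner x y))\<^sup>2)"
    by (simp only: complex_norm_square mult.commute)
  then have "cinner (c *\<^sub>C x) y = of_real (cmod (cinner x y))"
    using False by (simp add: cinner_scaleC_left c_def power2_eq_square)
  then have "cmod (cinner x y) = inner (c *\<^sub>C x) y"
    using Re_cinner[of "c *\<^sub>C x" y] by simp
  also have "\<dots> \<le> norm (c *\<^sub>C x) * norm y"
    by (rule norm_cauchy_schwarz)
  finally show ?thesis by (simp add: norm_scaleC c)
qed simp

lemma cinner_scaleR_left: "cinner (r *\<^sub>R x) y = r *\<^sub>R cinner x (y::'a::complex_inner)"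
  by (simp only: scaleC_of_real[of r x, symmetric] cinner_scaleC_left scaleR_conv_of_real)

lemma cinner_scaleR_right: "cinner x (r *\<^sub>R y) = r *\<^sub>R cinner x (y::'a::complex_inner)"
  by (simp only: scaleC_of_real[of r y, symmetric] cinner_scaleC_right scaleR_conv_of_real
      complex_cnj_complex_of_real)

interpretation cinner: bounded_bilinear "cinner :: 'a::complex_inner \<Rightarrow> 'a \<Rightarrow> complex"
proof
  show "\<exists>K. \<forall>x y::'a. cmod (cinner x y) \<le> norm x * norm y * K"
    by (rule exI[of _ 1]) (simp add: cinner_Cauchy_Schwarz)
qed (rule cinner_add_left cinner_add_right cinner_scaleR_left cinner_scaleR_right)+

interpretation scaleC: bounded_bilinear "scaleC :: complex \<Rightarrow> 'a \<Rightarrow> 'a::complex_inner"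
proof
  fix c :: complex and x :: 'a and r :: real
  show "(r *\<^sub>R c) *\<^sub>C x = r *\<^sub>R c *\<^sub>C x"
    by (simp only: scaleC_of_real[of r "c *\<^sub>C x", symmetric] scaleC_scaleC scaleR_conv_of_real)
  show "c *\<^sub>C r *\<^sub>R x = r *\<^sub>R c *\<^sub>C x"
    by (simp only: scaleC_of_real[symmetric] scaleC_scaleC mult.commute)
qed (auto simp: scaleC_add_left scaleC_add_right norm_scaleC intro!: exI[of _ 1])

lemma cinner_extI:
  fixes x y :: "'a::complex_inner"
  assumes "\<And>z. cinner x z = cinner y z"
  shows "x = y"
  using assms[of "x - y"] cinner_self[of "x - y"] by (simp add: cinner.diff_left)

section \<open>Riesz representation by minimization\<close>

lemma Riesz_real:
  fixes f :: "'a::{real_inner,complete_space} \<Rightarrow> real"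
  assumes "bounded_linear f"
  obtains z where "\<And>x. f x = inner z x"
proof -
  interpret bounded_linear f by fact
  obtain K where K: "\<And>x. norm (f x) \<le> norm x * K" using bounded by blast
  \<comment> \<open>If \<open>f\<close> is represented by \<open>z\<close>, then \<open>J x\<close>
    equals \<open>(norm (x - z))\<^sup>2 - (norm z)\<^sup>2\<close>, so the representing vector is
    sought as a minimizer of \<open>J\<close>. The parallelogram identity below makes a minimizing
    sequence Cauchy.\<close>
  define J where "J x = (norm x)\<^sup>2 - 2 * f x" for x
  have J_ge: "- K\<^sup>2 \<le> J x" for x
  proof -
    have "f x \<le> norm x * K" using K[of x] by simp
    moreover have "0 \<le> (norm x - K)\<^sup>2" by simp
    ultimately show ?thesis unfolding J_def power2_diff by linarith
  qed
  then have bdd: "bdd_below (range J)" by (auto intro!: bdd_belowI)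
  define d where "d = Inf (range J)"
  have d: "d \<le> J x" for x unfolding d_def by (rule cInf_lower[OF _ bdd]) simp
  have "\<exists>x. J x < d + inverse (real (Suc n))" for n
  proof -
    have "Inf (range J) < d + inverse (real (Suc n))" by (simp add: d_def)
    then show ?thesis using cInf_lessD[of "range J"] by blast
  qed
  then obtain X where X: "\<And>n. J (X n) < d + inverse (real (Suc n))" by metis
  have parallelogram: "J x + J y - 2 * J ((1 / 2) *\<^sub>R (x + y)) = (norm (x - y))\<^sup>2 / 2" for x y
    unfolding J_def scaleR add power2_norm_eq_inner by (simp add: algebra_simps inner_commute)
  have diff: "(norm (x - y))\<^sup>2 \<le> 2 * (J x - d) + 2 * (J y - d)" for x y
  proof -
    have "J x + J y - 2 * m = (norm (x - y))\<^sup>2 / 2 \<Longrightarrow> d \<le> m \<Longrightarrow> ?thesis" for m by argo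
    then show ?thesis using parallelogram d by blast
  qed
  have "Cauchy X"
  proof (rule metric_CauchyI)
    fix e :: real assume "e > 0"
    then obtain M where M: "inverse (real (Suc M)) < e\<^sup>2 / 4"
      using reals_Archimedean[of "e\<^sup>2 / 4"] by auto
    have close: "J (X n) - d < e\<^sup>2 / 4" if "n \<ge> M" for n
    proof -
      have "inverse (real (Suc n)) \<le> inverse (real (Suc M))" using that by simp
      then show ?thesis using X[of n] M by linarith
    qed
    have "dist (X m) (X n) < e" if "m \<ge> M" "n \<ge> M" for m n
    proof -
      have "(norm (X m - X n))\<^sup>2 < e\<^sup>2"
        using diff[of "X m" "X n"] close[OF that(1)] close[OF that(2)] by argo
      then show ?thesis using \<open>e > 0\<close> by (simp add: dist_norm power_less_imp_less_base)
    qed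
    then show "\<exists>M. \<forall>m\<ge>M. \<forall>n\<ge>M. dist (X m) (X n) < e" by blast
  qed
  then obtain z where z: "X \<longlonglongrightarrow> z" by (auto simp: Cauchy_convergent_iff convergent_def)
  have "(\<lambda>n. J (X n)) \<longlonglongrightarrow> J z" unfolding J_def by (intro tendsto_intros z tendsto)
  moreover have "(\<lambda>n. d + inverse (real (Suc n))) \<longlonglongrightarrow> d + 0"
    by (intro tendsto_intros LIMSEQ_inverse_real_of_nat)
  ultimately have Jz: "J z \<le> d"
    using X by (intro LIMSEQ_le[of "\<lambda>n. J (X n)"]) (auto intro: less_imp_le)
  have "f x = inner z x" for x
  proof (cases "x = 0")
    case False
    define b where "b = inner z x - f x"
    \<comment> \<open>This \<open>t\<close> minimizes the quadratic
      \<open>t\<^sup>2 * (norm x)\<^sup>2 + 2 * t * b\<close>. The value there is minus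
      \<open>b\<^sup>2 / (norm x)\<^sup>2\<close>, which the minimality of \<open>z\<close> forbids
      unless \<open>b = 0\<close>.\<close>
    define t where "t = - b / (norm x)\<^sup>2"
    have "J (z + t *\<^sub>R x) = J z + t\<^sup>2 * (norm x)\<^sup>2 + 2 * t * b"
      unfolding J_def b_def add scaleR power2_norm_eq_inner
      by (simp add: algebra_simps inner_commute power2_eq_square)
    then have "0 \<le> t\<^sup>2 * (norm x)\<^sup>2 + 2 * t * b" using d[of "z + t *\<^sub>R x"] Jz by linarith
    also have "\<dots> = - (b\<^sup>2 / (norm x)\<^sup>2)"
      using False by (simp add: t_def field_simps power2_eq_square)
    finally have "b\<^sup>2 / (norm x)\<^sup>2 \<le> 0" by simp
    then have "b = 0" using False by (simp add: divide_le_0_iff)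
    then show ?thesis by (simp add: b_def)
  qed (simp add: zero)
  then show ?thesis by (rule that)
qed

text \<open>A complex-linear functional is determined by its real part, since its imaginary part at
  \<open>x\<close> is minus its real part at \<open>\<i> *\<^sub>C x\<close>.\<close>

lemma Riesz_complex:
  fixes f :: "'a::chilbert_space \<Rightarrow> complex"
  assumes "bounded_linear f" and f: "\<And>c x. f (c *\<^sub>C x) = c * f x"
  obtains z where "\<And>x. f x = cinner x z"
proof -
  have "bounded_linear (\<lambda>x. Re (f x))"
    by (rule bounded_linear_compose[OF bounded_linear_Re assms(1)])
  then obtain z where z: "\<And>x. Re (f x) = inner z x" by (rule Riesz_real) blast
  then have Re: "Re (f x) = Re (cinner x z)" for x by (simp add: Re_cinner inner_commute)
  have "f x = cinner x z" for x
  proof (rule complex_eqI)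
    show "Im (f x) = Im (cinner x z)"
      using Re[of "\<i> *\<^sub>C x"] by (simp add: f cinner_scaleC_left)
  qed (rule Re)
  then show ?thesis by (rule that)
qed

subsection \<open>Bounded operators and adjoints\<close>

lemma bopsD: "T \<in> bops \<Longrightarrow> blinfun_apply T (c *\<^sub>C x) = c *\<^sub>C blinfun_apply T x"
  by (simp add: bops_def)

lemma scaleC_blinfun_apply [simp]: "blinfun_apply (c *\<^sub>C T) x = c *\<^sub>C blinfun_apply T x"
  by transfer simp

lemma bops_id [simp]: "id_blinfun \<in> bops"
  and bops_0 [simp]: "0 \<in> bops"
  and bops_compose [simp]: "S \<in> bops \<Longrightarrow> T \<in> bops \<Longrightarrow> S o\<^sub>L T \<in> bops"
  and bops_add [simp]: "T1 \<in> bops \<Longrightarrow> T2 \<in> bops \<Longrightarrow> T1 + T2 \<in> bops"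
  and bops_diff [simp]: "T1 \<in> bops \<Longrightarrow> T2 \<in> bops \<Longrightarrow> T1 - T2 \<in> bops"
  and bops_scaleR [simp]: "T1 \<in> bops \<Longrightarrow> r *\<^sub>R T1 \<in> bops"
  by (auto simp: bops_def blinfun.add_left blinfun.diff_left scaleC_add_right
      blinfun.scaleR_left scaleC.diff_right scaleC.scaleR_right)

lemma bops_scaleC [simp]: "T \<in> bops \<Longrightarrow> c *\<^sub>C T \<in> bops"
  by (simp add: bops_def scaleC_scaleC mult.commute)

lemma bops_sum [simp]: "(\<And>i. i \<in> I \<Longrightarrow> T i \<in> bops) \<Longrightarrow> sum T I \<in> bops"
  by (induction I rule: infinite_finite_induct) auto

lemma closed_bops: "closed (bops :: ('a::complex_inner \<Rightarrow>\<^sub>L 'b::complex_inner) set)"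
  unfolding bops_def
  by (intro closed_Collect_all closed_Collect_eq continuous_intros
      bounded_linear.continuous_on[OF bounded_linear_scaleC])

section \<open>Existence and calculus of adjoints\<close>

lemma adj_exists:
  fixes T :: "'a::chilbert_space \<Rightarrow>\<^sub>L 'b::complex_inner"
  assumes T: "T \<in> bops"
  shows "\<exists>S. \<forall>x y. cinner (blinfun_apply T x) y = cinner x (blinfun_apply S y)"
proof -
  have "\<exists>z. \<forall>x. cinner (blinfun_apply T x) y = cinner x z" for y
    by (rule Riesz_complex[of "\<lambda>x. cinner (blinfun_apply T x) y"])
       (auto intro!: bounded_linear_compose[OF cinner.bounded_linear_left] blinfun.bounded_linear_right
         simp: bopsD[OF T] cinner_scaleC_left)
  then obtain S where S: "\<And>x y. cinner (blinfun_apply T x) y = cinner x (S y)" by metis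
  have S': "cinner (S y) x = cinner y (blinfun_apply T x)" for x y
    using S cinner_commute by metis
  have "bounded_linear S"
  proof (rule bounded_linear_intro[where K = "norm T"])
    show "S (x + y) = S x + S y" for x y
      by (rule cinner_extI) (simp add: S' cinner_add_left)
    show "S (r *\<^sub>R x) = r *\<^sub>R S x" for r x
      by (rule cinner_extI) (simp add: S' cinner_scaleR_left)
    show "norm (S y) \<le> norm y * norm T" for y
    proof -
      have "(norm (S y))\<^sup>2 = cmod (cinner (S y) (S y))" by (simp add: cinner_self del: of_real_power)
      also have "\<dots> \<le> norm y * (norm T * norm (S y))"
        unfolding S' by (intro order.trans[OF cinner_Cauchy_Schwarz] mult_left_mono norm_blinfun) simp
      finally have "norm (S y) * norm (S y) \<le> (norm y * norm T) * norm (S y)"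
        by (simp add: power2_eq_square mult.assoc)
      then show ?thesis by (cases "S y = 0") auto
    qed
  qed
  then show ?thesis
    by (intro exI[of _ "Blinfun S"]) (simp add: bounded_linear_Blinfun_apply S)
qed

lemma adjI:
  assumes "\<And>x y. cinner (blinfun_apply T x) y = cinner x (blinfun_apply S y)"
  shows "adj T = S"
  unfolding adj_def
proof (rule the_equality)
  show "\<forall>x y. cinner (blinfun_apply T x) y = cinner x (blinfun_apply S y)" using assms by blast
  fix S' assume "\<forall>x y. cinner (blinfun_apply T x) y = cinner x (blinfun_apply S' y)"
  then have "cinner x (blinfun_apply S' y) = cinner x (blinfun_apply S y)" for x y
    using assms by metis
  then have "cinner (blinfun_apply S' y) x = cinner (blinfun_apply S y) x" for x y
    using cinner_commute by metis
  then show "S' = S"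
    by (intro blinfun_eqI) (rule cinner_extI)
qed

lemma cinner_adj_right:
  fixes T :: "'a::chilbert_space \<Rightarrow>\<^sub>L 'b::complex_inner"
  assumes "T \<in> bops"
  shows "cinner x (blinfun_apply (adj T) y) = cinner (blinfun_apply T x) y"
  using adj_exists[OF assms] adjI by metis

lemma cinner_adj_left:
  fixes T :: "'a::chilbert_space \<Rightarrow>\<^sub>L 'b::complex_inner"
  assumes "T \<in> bops"
  shows "cinner (blinfun_apply (adj T) y) x = cinner y (blinfun_apply T x)"
  using cinner_adj_right[OF assms, of x y] cinner_commute by metis

lemma bops_adj [simp]:
  fixes T :: "'a::chilbert_space \<Rightarrow>\<^sub>L 'b::complex_inner"
  assumes "T \<in> bops"
  shows "adj T \<in> bops"
  unfolding bops_def
  by (intro CollectI allI, rule cinner_extI)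
     (simp only: cinner_adj_left[OF assms] cinner_scaleC_left)

lemma adj_compose:
  fixes T :: "'a::chilbert_space \<Rightarrow>\<^sub>L 'b::chilbert_space" and S :: "'b \<Rightarrow>\<^sub>L 'c::complex_inner"
  assumes "S \<in> bops" "T \<in> bops"
  shows "adj (S o\<^sub>L T) = adj T o\<^sub>L adj S"
  by (rule adjI) (simp add: cinner_adj_right assms)

lemma adj_id [simp]: "adj id_blinfun = id_blinfun"
  by (rule adjI) simp

lemma adj_add:
  fixes T :: "'a::chilbert_space \<Rightarrow>\<^sub>L 'b::complex_inner"
  assumes "S \<in> bops" "T \<in> bops"
  shows "adj (S + T) = adj S + adj T"
  by (rule adjI) (simp add: cinner_adj_right assms blinfun.add_left cinner_add_left cinner_add_right)

lemma adj_diff: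
  fixes T :: "'a::chilbert_space \<Rightarrow>\<^sub>L 'b::complex_inner"
  assumes "S \<in> bops" "T \<in> bops"
  shows "adj (S - T) = adj S - adj T"
  by (rule adjI) (simp add: cinner_adj_right assms blinfun.diff_left cinner.diff_left cinner.diff_right)

lemma adj_scaleC:
  fixes T :: "'a::chilbert_space \<Rightarrow>\<^sub>L 'b::complex_inner"
  assumes "T \<in> bops"
  shows "adj (c *\<^sub>C T) = cnj c *\<^sub>C adj T"
  by (rule adjI) (simp add: cinner_adj_right assms cinner_scaleC_left cinner_scaleC_right)

subsection \<open>The positive square root of a strict contraction's complement\<close>

interpretation blinfun_compose: bounded_bilinear
    "(o\<^sub>L) :: 'b::real_normed_vector \<Rightarrow>\<^sub>L 'c::real_normed_vector \<Rightarrow>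
      'a::real_normed_vector \<Rightarrow>\<^sub>L 'b \<Rightarrow> 'a \<Rightarrow>\<^sub>L 'c"
  by (rule bounded_bilinear_blinfun_compose)

lemma blinfun_compose_id [simp]: "id_blinfun o\<^sub>L T = T" "T o\<^sub>L id_blinfun = T"
  by (rule blinfun_eqI, simp)+

lemma blinfun_compose_assoc: "(R o\<^sub>L S) o\<^sub>L T = R o\<^sub>L (S o\<^sub>L T)"
  by (rule blinfun_eqI) simp

definition symmetric_op :: "('a::complex_inner \<Rightarrow>\<^sub>L 'a) \<Rightarrow> bool" where
  "symmetric_op T \<longleftrightarrow> (\<forall>x y. cinner (blinfun_apply T x) y = cinner x (blinfun_apply T y))"

lemma symmetric_opD: "symmetric_op T \<Longrightarrow> cinner (blinfun_apply T x) y = cinner x (blinfun_apply T y)"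
  by (simp add: symmetric_op_def)

lemma closed_symmetric_op: "closed {T :: 'a::complex_inner \<Rightarrow>\<^sub>L 'a. symmetric_op T}"
  unfolding symmetric_op_def
  by (intro closed_Collect_all closed_Collect_eq continuous_intros
      bounded_linear.continuous_on[OF cinner.bounded_linear_left]
      bounded_linear.continuous_on[OF cinner.bounded_linear_right])

text \<open>Carrying this closed condition through the fixed point iteration makes the square root
  commute with everything that commutes with \<open>Q\<close>; the uniqueness of the positive root
  rests on it.\<close>

lemma closed_commuting:
  "closed {T :: 'a::real_normed_vector \<Rightarrow>\<^sub>L 'a. \<forall>B. B o\<^sub>L Q = Q o\<^sub>L B \<longrightarrow> B o\<^sub>L T = T o\<^sub>L B}"
proof -
  have "closed {T. B o\<^sub>L Q = Q o\<^sub>L B \<longrightarrow> B o\<^sub>L T = T o\<^sub>L B}" for B :: "'a \<Rightarrow>\<^sub>L 'a"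
    by (cases "B o\<^sub>L Q = Q o\<^sub>L B") (auto intro!: closed_Collect_eq continuous_intros)
  then show ?thesis by (intro closed_Collect_all)
qed

text \<open>
  With \<open>S = I - Y\<close> the equation \<open>S\<^sup>2 = I - Q\<close> reads \<open>Y = (Q + Y\<^sup>2) / 2\<close>, and the right-hand side is a
  contraction on the ball of radius \<open>1 - sqrt (1 - norm Q) < 1\<close>.
\<close>

lemma sqrt_fixed_point:
  fixes Q :: "'a::chilbert_space \<Rightarrow>\<^sub>L 'a"
  assumes "Q \<in> bops" "symmetric_op Q" "norm Q < 1"
  obtains Y where "norm Y < 1" "Y \<in> bops" "symmetric_op Y"
    "\<And>B. B o\<^sub>L Q = Q o\<^sub>L B \<Longrightarrow> B o\<^sub>L Y = Y o\<^sub>L B" "(1 / 2) *\<^sub>R (Q + (Y o\<^sub>L Y)) = Y"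
proof -
  \<comment> \<open>The smaller root of \<open>norm Q + c * c = 2 * c\<close>. The equation says
    that the bound \<open>(norm Q + c * c) / 2\<close> for \<open>norm (F Y)\<close> is again
    \<open>c\<close>, so \<open>F\<close> maps the ball of radius \<open>c\<close> into
    itself.\<close>
  define c where "c = 1 - sqrt (1 - norm Q)"
  have c: "0 \<le> c" "c < 1" using assms(3) by (simp_all add: c_def)
  have c2: "norm Q + c * c = 2 * c"
  proof -
    have "(1 - c) * (1 - c) = 1 - norm Q" using assms(3) by (simp add: c_def)
    then show ?thesis by (simp add: algebra_simps)
  qed
  define M where "M = {Y. norm Y \<le> c} \<inter> bops \<inter> {Y. symmetric_op Y} \<inter>
    {Y :: 'a \<Rightarrow>\<^sub>L 'a. \<forall>B. B o\<^sub>L Q = Q o\<^sub>L B \<longrightarrow> B o\<^sub>L Y = Y o\<^sub>L B}"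
  define F where "F Y = (1 / 2) *\<^sub>R (Q + (Y o\<^sub>L Y))" for Y
  have "closed M"
    unfolding M_def
    by (intro closed_Int closed_bops closed_symmetric_op closed_commuting closed_Collect_le
        continuous_intros)
  then have "complete M" by (simp add: complete_eq_closed)
  moreover have "M \<noteq> {}"
  proof -
    have "0 \<in> M" using c by (auto simp: M_def symmetric_op_def cinner.zero_left cinner.zero_right)
    then show ?thesis by blast
  qed
  moreover have "F ` M \<subseteq> M"
  proof (intro image_subsetI)
    fix Y assume Y: "Y \<in> M"
    then have Y: "norm Y \<le> c" "Y \<in> bops" "symmetric_op Y"
      and Y_comm: "\<And>B. B o\<^sub>L Q = Q o\<^sub>L B \<Longrightarrow> B o\<^sub>L Y = Y o\<^sub>L B"
      unfolding M_def by blast+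
    have "norm (F Y) \<le> (norm Q + norm (Y o\<^sub>L Y)) / 2"
      using norm_triangle_ineq[of Q "Y o\<^sub>L Y"] by (simp add: F_def)
    also have "\<dots> \<le> (norm Q + c * c) / 2"
      by (intro divide_right_mono add_left_mono order.trans[OF norm_blinfun_compose] mult_mono)
        (use Y(1) c in auto)
    finally have "norm (F Y) \<le> c" by (simp add: c2)
    moreover have "F Y \<in> bops" using Y(2) assms(1) by (simp add: F_def)
    moreover have "symmetric_op (F Y)"
      using Y(3) assms(2) unfolding F_def symmetric_op_def
      by (simp add: blinfun.scaleR_left blinfun.add_left cinner_scaleR_left cinner_scaleR_right
          cinner_add_left cinner_add_right)
    moreover have "B o\<^sub>L F Y = F Y o\<^sub>L B" if "B o\<^sub>L Q = Q o\<^sub>L B" for B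
    proof -
      have "B o\<^sub>L Y = Y o\<^sub>L B" by (rule Y_comm[OF that])
      then have "B o\<^sub>L (Y o\<^sub>L Y) = (Y o\<^sub>L Y) o\<^sub>L B" by (metis blinfun_compose_assoc)
      then show ?thesis using that
        by (simp add: F_def blinfun_compose.add_left blinfun_compose.add_right
            blinfun_compose.scaleR_left blinfun_compose.scaleR_right)
    qed
    ultimately show "F Y \<in> M" unfolding M_def by blast
  qed
  moreover have "dist (F Y) (F Z) \<le> c * dist Y Z" if "Y \<in> M" "Z \<in> M" for Y Z
  proof -
    have YZ: "norm Y \<le> c" "norm Z \<le> c" using that by (auto simp only: M_def)
    \<comment> \<open>This splitting of a difference of squares is valid although \<open>Y\<close>
      and \<open>Z\<close> need not commute.\<close>
    have "F Y - F Z = (1 / 2) *\<^sub>R ((Y o\<^sub>L (Y - Z)) + ((Y - Z) o\<^sub>L Z))"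
      by (simp add: F_def blinfun_compose.diff_left blinfun_compose.diff_right algebra_simps)
    then have "dist (F Y) (F Z) = norm ((Y o\<^sub>L (Y - Z)) + ((Y - Z) o\<^sub>L Z)) / 2"
      by (simp add: dist_norm)
    also have "\<dots> \<le> (norm Y * norm (Y - Z) + norm (Y - Z) * norm Z) / 2"
      by (intro divide_right_mono order.trans[OF norm_triangle_ineq] add_mono norm_blinfun_compose) simp
    also have "\<dots> \<le> (c * norm (Y - Z) + norm (Y - Z) * c) / 2"
      by (intro divide_right_mono add_mono mult_mono YZ) (auto simp: c)
    finally show ?thesis by (simp add: dist_norm mult.commute)
  qed
  ultimately have "\<exists>!Y\<in>M. F Y = Y" by (rule Banach_fix[OF _ _ c])
  then obtain Y where "Y \<in> M" "F Y = Y" by blast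
  moreover have "norm Y < 1" using \<open>Y \<in> M\<close> c unfolding M_def by auto
  ultimately show ?thesis using that[of Y] unfolding M_def F_def by blast
qed

text \<open>A second positive root \<open>R\<close> commutes with \<open>Q = I - R\<^sup>2\<close>,
  hence with \<open>Y\<close> and with \<open>S\<close>. Then \<open>(S + R) (S - R) = 0\<close>, so
  for \<open>y\<close> in the range of \<open>S - R\<close> the forms of \<open>S\<close> and
  \<open>R\<close> at \<open>y\<close> add up to 0. Both are nonnegative, and
  \<open>norm Y < 1\<close> bounds the form of \<open>S\<close> below by a positive multiple of
  \<open>(norm y)\<^sup>2\<close>; so \<open>y = 0\<close>.\<close>

lemma sqrt_op_properties:
  fixes Q :: "'a::chilbert_space \<Rightarrow>\<^sub>L 'a"
  assumes "Q \<in> bops" "symmetric_op Q" "norm Q < 1"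
  shows "sqrt_op (id_blinfun - Q) \<in> bops" "symmetric_op (sqrt_op (id_blinfun - Q))"
    and "sqrt_op (id_blinfun - Q) o\<^sub>L sqrt_op (id_blinfun - Q) = id_blinfun - Q"
proof -
  obtain Y where Y: "norm Y < 1" "Y \<in> bops" "symmetric_op Y"
    "\<And>B. B o\<^sub>L Q = Q o\<^sub>L B \<Longrightarrow> B o\<^sub>L Y = Y o\<^sub>L B" "(1 / 2) *\<^sub>R (Q + (Y o\<^sub>L Y)) = Y"
    by (rule sqrt_fixed_point[OF assms]) blast
  define S where "S = id_blinfun - Y"
  have S: "S \<in> bops" "symmetric_op S"
    using Y(2,3) by (simp_all add: S_def symmetric_op_def blinfun.diff_left cinner.diff_left cinner.diff_right)
  have "Q + (Y o\<^sub>L Y) = 2 *\<^sub>R ((1 / 2) *\<^sub>R (Q + (Y o\<^sub>L Y)))" by simp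
  then have "Q + (Y o\<^sub>L Y) = Y + Y" unfolding Y(5) by (simp add: scaleR_2)
  then have "Y o\<^sub>L Y = Y + Y - Q" by (simp add: algebra_simps)
  moreover have "S o\<^sub>L S = id_blinfun - (Y + Y) + (Y o\<^sub>L Y)"
    by (rule blinfun_eqI) (simp add: S_def blinfun.diff_left blinfun.diff_right blinfun.add_left)
  ultimately have SS: "S o\<^sub>L S = id_blinfun - Q" by simp
  have S_real: "Im (cinner (blinfun_apply S x) x) = 0" for x
    using arg_cong[OF cinner_commute[of "blinfun_apply S x" x], of Im] symmetric_opD[OF S(2), of x x]
    by simp
  have S_ge: "(1 - norm Y) * (norm x)\<^sup>2 \<le> Re (cinner (blinfun_apply S x) x)" for x
  proof -
    have "Re (cinner (blinfun_apply Y x) x) \<le> norm (blinfun_apply Y x) * norm x"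
      by (rule order.trans[OF complex_Re_le_cmod cinner_Cauchy_Schwarz])
    also have "\<dots> \<le> norm Y * norm x * norm x" by (intro mult_right_mono norm_blinfun) simp
    finally show ?thesis
      by (simp add: S_def blinfun.diff_left cinner.diff_left cinner_self algebra_simps power2_eq_square)
  qed
  have S_ge0: "0 \<le> Re (cinner (blinfun_apply S x) x)" for x
    using Y(1) by (intro order.trans[OF _ S_ge]) simp
  have pos: "positive_op S"
    unfolding positive_op_def using S(1) S_real S_ge0 by (auto simp: complex_nonneg_Reals_iff)
  have "sqrt_op (id_blinfun - Q) = S"
    unfolding sqrt_op_def
  proof (rule the_equality)
    show "positive_op S \<and> S o\<^sub>L S = id_blinfun - Q" using pos SS by blast
    fix R :: "'a \<Rightarrow>\<^sub>L 'a" assume R: "positive_op R \<and> R o\<^sub>L R = id_blinfun - Q"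
    then have RR: "R o\<^sub>L R = id_blinfun - Q" by blast
    have "Q = id_blinfun - (R o\<^sub>L R)" using RR by simp
    then have "R o\<^sub>L Q = Q o\<^sub>L R"
      by (intro blinfun_eqI) (simp add: blinfun.diff_left blinfun.diff_right)
    then have "R o\<^sub>L Y = Y o\<^sub>L R" by (rule Y(4))
    then have RS: "R o\<^sub>L S = S o\<^sub>L R"
      by (simp add: S_def blinfun_compose.diff_left blinfun_compose.diff_right)
    have "blinfun_apply S x - blinfun_apply R x = 0" for x
    proof -
      define y where "y = blinfun_apply S x - blinfun_apply R x"
      have "blinfun_apply (R o\<^sub>L R) x = blinfun_apply (S o\<^sub>L S) x" by (simp add: RR SS)
      moreover have "blinfun_apply (R o\<^sub>L S) x = blinfun_apply (S o\<^sub>L R) x" by (simp add: RS)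
      ultimately have "blinfun_apply S y + blinfun_apply R y = 0"
        by (simp add: y_def blinfun.diff_right)
      then have "cinner (blinfun_apply S y) y + cinner (blinfun_apply R y) y = 0"
        by (metis cinner_add_left cinner.zero_left)
      then have "Re (cinner (blinfun_apply S y) y) + Re (cinner (blinfun_apply R y) y) = 0"
        by (metis plus_complex.sel(1) zero_complex.sel(1))
      moreover have "0 \<le> Re (cinner (blinfun_apply R y) y)"
        using R by (simp add: positive_op_def complex_nonneg_Reals_iff)
      ultimately have "Re (cinner (blinfun_apply S y) y) \<le> 0"
        by linarith
      then have "(1 - norm Y) * (norm y)\<^sup>2 \<le> 0" using S_ge[of y] by linarith
      then show ?thesis using Y(1) by (simp add: mult_le_0_iff y_def)
    qed
    then show "R = S" by (intro blinfun_eqI) simp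
  qed
  then show "sqrt_op (id_blinfun - Q) \<in> bops" "symmetric_op (sqrt_op (id_blinfun - Q))"
    "sqrt_op (id_blinfun - Q) o\<^sub>L sqrt_op (id_blinfun - Q) = id_blinfun - Q"
    using S SS by simp_all
qed

subsection \<open>Words in a row contraction\<close>

lemma word_op_append: "word_op X (\<alpha> @ \<beta>) = word_op X \<alpha> o\<^sub>L word_op X \<beta>"
  by (induction \<alpha>) (simp_all add: blinfun_compose_assoc)

lemma bops_word_op: "(\<And>i. X i \<in> bops) \<Longrightarrow> word_op X \<alpha> \<in> bops"
  by (induction \<alpha>) simp_all

lemma row_ballD:
  assumes "X \<in> row_ball"
  shows "X i \<in> bops" "norm (\<Sum>i\<in>UNIV. X i o\<^sub>L adj (X i)) < 1"
  using assms by (auto simp: row_ball_def)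

lemma norm_adj_apply_square:
  fixes T :: "'a::chilbert_space \<Rightarrow>\<^sub>L 'b::chilbert_space"
  assumes "T \<in> bops"
  shows "complex_of_real ((norm (blinfun_apply (adj T) y))\<^sup>2) = cinner (blinfun_apply (T o\<^sub>L adj T) y) y"
  by (simp only: cinner_self[symmetric] cinner_adj_right[OF assms] blinfun_apply_blinfun_compose)

lemma blinfun_apply_sum: "blinfun_apply (sum T I) x = (\<Sum>i\<in>I. blinfun_apply (T i) x)"
  by (induction I rule: infinite_finite_induct) (simp_all add: blinfun.add_left blinfun.zero_left)

lemma sum_norm_adj_square:
  fixes X :: "'n::finite \<Rightarrow> 'h::chilbert_space \<Rightarrow>\<^sub>L 'h"
  assumes "X \<in> row_ball"
  shows "complex_of_real (\<Sum>i\<in>UNIV. (norm (blinfun_apply (adj (X i)) y))\<^sup>2) =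
    cinner (blinfun_apply (\<Sum>i\<in>UNIV. X i o\<^sub>L adj (X i)) y) y"
  using row_ballD(1)[OF assms] by (simp add: blinfun_apply_sum cinner.sum_left norm_adj_apply_square[symmetric]
      del: blinfun_apply_blinfun_compose of_real_power)

lemma sum_norm_adj_le:
  fixes X :: "'n::finite \<Rightarrow> 'h::chilbert_space \<Rightarrow>\<^sub>L 'h"
  assumes "X \<in> row_ball"
  shows "(\<Sum>i\<in>UNIV. (norm (blinfun_apply (adj (X i)) y))\<^sup>2) \<le>
    norm (\<Sum>i\<in>UNIV. X i o\<^sub>L adj (X i)) * (norm y)\<^sup>2"
proof -
  let ?Q = "\<Sum>i\<in>UNIV. X i o\<^sub>L adj (X i)"
  have "(\<Sum>i\<in>UNIV. (norm (blinfun_apply (adj (X i)) y))\<^sup>2) = Re (cinner (blinfun_apply ?Q y) y)"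
    using arg_cong[OF sum_norm_adj_square[OF assms, of y], of Re] by simp
  also have "\<dots> \<le> norm (blinfun_apply ?Q y) * norm y"
    by (rule order.trans[OF complex_Re_le_cmod cinner_Cauchy_Schwarz])
  also have "\<dots> \<le> norm ?Q * norm y * norm y" by (intro mult_right_mono norm_blinfun) simp
  finally show ?thesis by (simp add: power2_eq_square mult.assoc)
qed

text \<open>The norm identity is the loss of square norm in one application of all the
  \<open>adj (X i)\<close>; summed over words, these losses telescope in
  \<open>has_sum_defect\<close>.\<close>

lemma defect_op_properties:
  fixes X :: "'n::finite \<Rightarrow> 'h::chilbert_space \<Rightarrow>\<^sub>L 'h"
  assumes X: "X \<in> row_ball"
  shows "defect_op X \<in> bops"
    and "(norm (blinfun_apply (defect_op X) y))\<^sup>2 =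
      (norm y)\<^sup>2 - (\<Sum>i\<in>UNIV. (norm (blinfun_apply (adj (X i)) y))\<^sup>2)"
proof -
  let ?Q = "\<Sum>i\<in>UNIV. X i o\<^sub>L adj (X i)"
  have Q: "?Q \<in> bops" using row_ballD(1)[OF X] by simp
  have sym: "symmetric_op ?Q"
    unfolding symmetric_op_def
    by (simp add: blinfun_apply_sum cinner.sum_left cinner.sum_right
        cinner_adj_right[OF row_ballD(1)[OF X], symmetric] cinner_adj_left[OF row_ballD(1)[OF X], symmetric])
  note sq = sqrt_op_properties[OF Q sym row_ballD(2)[OF X], folded defect_op_def]
  show "defect_op X \<in> bops" by (rule sq)
  have "complex_of_real ((norm (blinfun_apply (defect_op X) y))\<^sup>2) =
      cinner (blinfun_apply (defect_op X o\<^sub>L defect_op X) y) y"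
    by (simp add: cinner_self[symmetric] symmetric_opD[OF sq(2)] del: of_real_power)
  also have "\<dots> = of_real ((norm y)\<^sup>2 - (\<Sum>i\<in>UNIV. (norm (blinfun_apply (adj (X i)) y))\<^sup>2))"
    unfolding sq(3) of_real_diff sum_norm_adj_square[OF X]
    by (simp add: blinfun.diff_left cinner.diff_left cinner_self)
  finally show "(norm (blinfun_apply (defect_op X) y))\<^sup>2 =
      (norm y)\<^sup>2 - (\<Sum>i\<in>UNIV. (norm (blinfun_apply (adj (X i)) y))\<^sup>2)"
    unfolding of_real_eq_iff .
qed

subsection \<open>Sums over words\<close>

lemma finite_words [simp]: "finite {\<alpha> :: 'n::finite list. length \<alpha> = k}"
  using finite_lists_length_eq[of "UNIV :: 'n set" k] by simp

lemma finite_words_le [simp]: "finite {\<alpha> :: 'n::finite list. length \<alpha> \<le> k}"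
  using finite_lists_length_le[of "UNIV :: 'n set" k] by simp

text \<open>Words are extended at the end because adjoints reverse the order: in
  \<open>adj (word_op X (\<alpha> @ [i]))\<close> the factor \<open>adj (X i)\<close> acts last, so
  one-step estimates apply to the vector already reached.\<close>

lemma words_Suc: "{\<alpha> :: 'n list. length \<alpha> = Suc k} = (\<lambda>(\<alpha>, i). \<alpha> @ [i]) ` ({\<alpha>. length \<alpha> = k} \<times> UNIV)"
proof (intro equalityI subsetI)
  fix \<alpha> :: "'n list" assume "\<alpha> \<in> {\<alpha>. length \<alpha> = Suc k}"
  then show "\<alpha> \<in> (\<lambda>(\<alpha>, i). \<alpha> @ [i]) ` ({\<alpha>. length \<alpha> = k} \<times> UNIV)"
    by (intro image_eqI[of _ _ "(butlast \<alpha>, last \<alpha>)"]) (cases \<alpha> rule: rev_cases; auto)+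
qed auto

lemma sum_words_Suc:
  "(\<Sum>\<alpha> | length (\<alpha> :: 'n::finite list) = Suc k. f \<alpha>) = (\<Sum>\<alpha> | length \<alpha> = k. \<Sum>i\<in>UNIV. f (\<alpha> @ [i]))"
  unfolding words_Suc sum.cartesian_product
  by (subst sum.reindex) (auto simp: inj_on_def case_prod_unfold)

text \<open>Fubini works with unordered sums over words, whereas \<open>free_holomorphic\<close>
  speaks of a series graded by length; this is the passage from the former to the latter.\<close>

lemma has_sum_words_imp_sums:
  fixes f :: "'n::finite list \<Rightarrow> 'a::real_normed_vector"
  assumes "(f has_sum s) UNIV"
  shows "(\<lambda>k. \<Sum>\<alpha> | length \<alpha> = k. f \<alpha>) sums s"
proof (rule has_sum_imp_sums)
  have "bij_betw snd (SIGMA k:UNIV. {\<alpha> :: 'n list. length \<alpha> = k}) UNIV"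
    by (rule bij_betwI[where g = "\<lambda>\<alpha>. (length \<alpha>, \<alpha>)"]) auto
  then have "((\<lambda>p. f (snd p)) has_sum s) (SIGMA k:UNIV. {\<alpha> :: 'n list. length \<alpha> = k})"
    using has_sum_reindex_bij_betw[of snd _ UNIV f s] assms by simp
  then show "((\<lambda>k. \<Sum>\<alpha> | length \<alpha> = k. f \<alpha>) has_sum s) UNIV"
    by (rule has_sum_SigmaD[of "\<lambda>p. f (snd p)"]) (auto intro!: has_sum_finite)
qed

text \<open>Every finite set of words lies below some length, so for nonnegative terms the graded
  series bounds all finite sums.\<close>

lemma summable_on_words:
  fixes f :: "'n::finite list \<Rightarrow> real"
  assumes f: "\<And>\<alpha>. 0 \<le> f \<alpha>" and sum: "summable (\<lambda>k. \<Sum>\<alpha> | length \<alpha> = k. f \<alpha>)"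
  shows "f summable_on UNIV"
proof (rule nonneg_bdd_above_summable_on)
  show "bdd_above (sum f ` {F. F \<subseteq> UNIV \<and> finite F})"
  proof (rule bdd_aboveI2)
    fix F :: "'n list set" assume "F \<in> {F. F \<subseteq> UNIV \<and> finite F}"
    then have F: "finite F" by simp
    define N where "N = Suc (Max (insert 0 (length ` F)))"
    have "F \<subseteq> (\<Union>k<N. {\<alpha>. length \<alpha> = k})"
      using F by (auto simp: N_def less_Suc_eq_le)
    then have "sum f F \<le> sum f (\<Union>k<N. {\<alpha>. length \<alpha> = k})"
      by (intro sum_mono2) (auto simp: f)
    also have "\<dots> = (\<Sum>k<N. \<Sum>\<alpha> | length \<alpha> = k. f \<alpha>)"
      by (rule sum.UNION_disjoint) auto
    also have "\<dots> \<le> (\<Sum>k. \<Sum>\<alpha> | length \<alpha> = k. f \<alpha>)"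
      by (rule sum_le_suminf[OF sum]) (auto intro: sum_nonneg f)
    finally show "sum f F \<le> (\<Sum>k. \<Sum>\<alpha> | length \<alpha> = k. f \<alpha>)" .
  qed
qed (simp add: f)

lemma has_sum_words:
  fixes f :: "'n::finite list \<Rightarrow> real"
  assumes "\<And>\<alpha>. 0 \<le> f \<alpha>" "(\<lambda>k. \<Sum>\<alpha> | length \<alpha> = k. f \<alpha>) sums s"
  shows "(f has_sum s) UNIV"
proof -
  have "(f has_sum infsum f UNIV) UNIV"
    using summable_on_words[of f] assms by (auto simp: sums_iff)
  moreover from has_sum_words_imp_sums[OF this] have "infsum f UNIV = s"
    using assms(2) by (simp add: sums_iff)
  ultimately show ?thesis by simp
qed

definition word_square_sum :: "('n::finite \<Rightarrow> 'h::complex_inner \<Rightarrow>\<^sub>L 'h) \<Rightarrow> 'h \<Rightarrow> nat \<Rightarrow> real" where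
  "word_square_sum X h k = (\<Sum>\<alpha> | length \<alpha> = k. (norm (blinfun_apply (adj (word_op X \<alpha>)) h))\<^sup>2)"

lemma adj_word_op_append:
  fixes X :: "'n::finite \<Rightarrow> 'h::chilbert_space \<Rightarrow>\<^sub>L 'h"
  assumes "X \<in> row_ball"
  shows "adj (word_op X (\<alpha> @ \<beta>)) = adj (word_op X \<beta>) o\<^sub>L adj (word_op X \<alpha>)"
  by (simp add: word_op_append adj_compose bops_word_op row_ballD(1)[OF assms])

lemma word_square_sum_le:
  fixes X :: "'n::finite \<Rightarrow> 'h::chilbert_space \<Rightarrow>\<^sub>L 'h"
  assumes X: "X \<in> row_ball"
  shows "word_square_sum X h k \<le> norm (\<Sum>i\<in>UNIV. X i o\<^sub>L adj (X i)) ^ k * (norm h)\<^sup>2"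
proof (induction k)
  case (Suc k)
  let ?q = "norm (\<Sum>i\<in>UNIV. X i o\<^sub>L adj (X i))"
  have "word_square_sum X h (Suc k) =
    (\<Sum>\<alpha> | length \<alpha> = k. \<Sum>i\<in>UNIV. (norm (blinfun_apply (adj (X i)) (blinfun_apply (adj (word_op X \<alpha>)) h)))\<^sup>2)"
    by (simp add: word_square_sum_def sum_words_Suc adj_word_op_append[OF X])
  also have "\<dots> \<le> (\<Sum>\<alpha> | length \<alpha> = k. ?q * (norm (blinfun_apply (adj (word_op X \<alpha>)) h))\<^sup>2)"
    by (intro sum_mono sum_norm_adj_le[OF X])
  also have "\<dots> = ?q * word_square_sum X h k"
    by (simp add: word_square_sum_def sum_distrib_left)
  also have "\<dots> \<le> ?q * (?q ^ k * (norm h)\<^sup>2)" by (intro mult_left_mono Suc) simp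
  finally show ?case by (simp add: mult.assoc)
qed (simp add: word_square_sum_def)

text \<open>The level sums telescope to \<open>(norm h)\<^sup>2\<close>, which makes the Poisson kernel an isometry.\<close>

lemma has_sum_defect:
  fixes X :: "'n::finite \<Rightarrow> 'h::chilbert_space \<Rightarrow>\<^sub>L 'h"
  assumes X: "X \<in> row_ball"
  shows "((\<lambda>\<alpha>. (norm (blinfun_apply (defect_op X) (blinfun_apply (adj (word_op X \<alpha>)) h)))\<^sup>2)
    has_sum (norm h)\<^sup>2) UNIV"
proof (rule has_sum_words)
  let ?q = "norm (\<Sum>i\<in>UNIV. X i o\<^sub>L adj (X i))"
  have "(\<lambda>k. ?q ^ k * (norm h)\<^sup>2) \<longlonglongrightarrow> 0 * (norm h)\<^sup>2"
    using row_ballD(2)[OF X] by (intro tendsto_intros LIMSEQ_power_zero) simp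
  then have lim: "(\<lambda>k. ?q ^ k * (norm h)\<^sup>2) \<longlonglongrightarrow> 0" by simp
  have "(\<lambda>k. word_square_sum X h k) \<longlonglongrightarrow> 0"
  proof (rule tendsto_sandwich[OF _ _ tendsto_const lim])
    show "\<forall>\<^sub>F k in sequentially. 0 \<le> word_square_sum X h k"
      by (simp add: word_square_sum_def sum_nonneg)
    show "\<forall>\<^sub>F k in sequentially. word_square_sum X h k \<le> ?q ^ k * (norm h)\<^sup>2"
      by (intro always_eventually allI word_square_sum_le[OF X])
  qed
  then have "(\<lambda>k. word_square_sum X h k - word_square_sum X h (Suc k)) sums (word_square_sum X h 0 - 0)"
    by (rule telescope_sums')
  then show "(\<lambda>k. \<Sum>\<alpha> | length \<alpha> = k. (norm (blinfun_apply (defect_op X)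
      (blinfun_apply (adj (word_op X \<alpha>)) h)))\<^sup>2) sums (norm h)\<^sup>2"
    by (simp add: word_square_sum_def sum_words_Suc adj_word_op_append[OF X] sum_subtractf
        defect_op_properties(2)[OF X])
qed simp

subsection \<open>Orthonormal families\<close>

definition orthonormal_on :: "'i set \<Rightarrow> ('i \<Rightarrow> 'h::complex_inner) \<Rightarrow> bool" where
  "orthonormal_on A e \<longleftrightarrow> (\<forall>k\<in>A. \<forall>l\<in>A. cinner (e k) (e l) = of_bool (k = l))"

lemma cinner_orthonormal_sum:
  assumes "orthonormal_on A e" "finite A" "l \<in> A"
  shows "cinner (\<Sum>k\<in>A. c k *\<^sub>C e k) (e l) = c l"
proof -
  have "cinner (\<Sum>k\<in>A. c k *\<^sub>C e k) (e l) = (\<Sum>k\<in>A. if k = l then c k else 0)"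
    using assms by (auto simp: cinner.sum_left cinner_scaleC_left orthonormal_on_def intro!: sum.cong)
  then show ?thesis using assms by simp
qed

lemma orthonormal_residual:
  assumes "orthonormal_on A e" "finite A" "l \<in> A"
  shows "cinner (v - (\<Sum>k\<in>A. cinner v (e k) *\<^sub>C e k)) (e l) = 0"
  using cinner_orthonormal_sum[OF assms] by (simp add: cinner.diff_left)

lemma orthonormal_on_insert:
  assumes "orthonormal_on A e" "a \<notin> A" "w \<noteq> 0" and w: "\<And>l. l \<in> A \<Longrightarrow> cinner w (e l) = 0"
  shows "orthonormal_on (insert a A) (e(a := complex_of_real (1 / norm w) *\<^sub>C w))"
proof -
  have "cinner (e l) w = 0" if "l \<in> A" for l
    using w[OF that] cinner_commute[of "e l" w] by simp
  then show ?thesis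
    using assms unfolding orthonormal_on_def
    by (auto simp: cinner_scaleC_left cinner_scaleC_right cinner_self power2_eq_square)
qed

text \<open>Gram-Schmidt, where a vector depending on the earlier ones contributes no new element.
  Indexing the family by a subset of \<open>J\<close> avoids choosing an enumeration.\<close>

lemma orthonormal_coefficients:
  fixes v :: "'i \<Rightarrow> 'h::complex_inner"
  assumes "finite J"
  shows "\<exists>A\<subseteq>J. \<exists>e c. orthonormal_on A e \<and> (\<forall>j\<in>J. v j = (\<Sum>l\<in>A. c j l *\<^sub>C e l))"
  using assms
proof (induction J)
  case empty
  show ?case by (auto simp: orthonormal_on_def)
next
  case (insert j J)
  then obtain A e c where A: "A \<subseteq> J" "orthonormal_on A e"
    and c: "\<And>i. i \<in> J \<Longrightarrow> v i = (\<Sum>l\<in>A. c i l *\<^sub>C e l)" by blast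
  have "finite A" using A(1) insert(1) finite_subset by blast
  have "j \<notin> A" using A(1) insert(2) by blast
  define w where "w = v j - (\<Sum>k\<in>A. cinner (v j) (e k) *\<^sub>C e k)"
  show ?case
  proof (cases "w = 0")
    case True
    have "v i = (\<Sum>l\<in>A. (c(j := \<lambda>l. cinner (v j) (e l))) i l *\<^sub>C e l)" if "i \<in> insert j J" for i
      using that c True by (auto simp: w_def)
    then show ?thesis using A by blast
  next
    case False
    define e' where "e' = e(j := complex_of_real (1 / norm w) *\<^sub>C w)"
    \<comment> \<open>The new coefficient is \<open>norm w\<close> for \<open>v j\<close>, undoing
      the normalization in \<open>e'\<close>, and 0 for the earlier vectors.\<close>
    define c' where "c' i l = (if l = j then of_bool (i = j) * complex_of_real (norm w)
      else if i = j then cinner (v j) (e l) else c i l)" for i l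
    have "orthonormal_on (insert j A) e'"
      unfolding e'_def
      by (rule orthonormal_on_insert)
         (use A \<open>j \<notin> A\<close> False orthonormal_residual[OF A(2) \<open>finite A\<close>] in \<open>auto simp: w_def\<close>)
    moreover have "v i = (\<Sum>l\<in>insert j A. c' i l *\<^sub>C e' l)" if "i \<in> insert j J" for i
    proof -
      have "(\<Sum>l\<in>A. c' i l *\<^sub>C e' l) = (\<Sum>l\<in>A. (if i = j then cinner (v j) (e l) else c i l) *\<^sub>C e l)"
        using \<open>j \<notin> A\<close> by (intro sum.cong) (auto simp: c'_def e'_def)
      then have "(\<Sum>l\<in>insert j A. c' i l *\<^sub>C e' l) =
          c' i j *\<^sub>C e' j + (\<Sum>l\<in>A. (if i = j then cinner (v j) (e l) else c i l) *\<^sub>C e l)"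
        using \<open>finite A\<close> \<open>j \<notin> A\<close> by simp
      moreover have "complex_of_real (norm w) *\<^sub>C complex_of_real (1 / norm w) *\<^sub>C w = w"
        using False by (simp add: scaleC_scaleC scaleC_one)
      ultimately show ?thesis
        using that c insert(2) by (auto simp: c'_def e'_def w_def)
    qed
    ultimately show ?thesis using A(1) by blast
  qed
qed

subsection \<open>Tensor products with the Fock space\<close>

lemma ell2_eqI: "(\<And>i. Rep_ell2 x i = Rep_ell2 y i) \<Longrightarrow> x = y"
  by (metis Rep_ell2_inject ext)

lemma ell2_tensor_scaleC_left: "(c *\<^sub>C x) \<otimes>\<^sub>2 h = c *\<^sub>C (x \<otimes>\<^sub>2 h)"
  and ell2_tensor_scaleC_right: "x \<otimes>\<^sub>2 (c *\<^sub>C h) = c *\<^sub>C (x \<otimes>\<^sub>2 h)"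
  by (rule ell2_eqI, simp add: ell2_tensor.rep_eq scaleC_ell2.rep_eq scaleC_scaleC scaleC_complex_def
      mult.commute)+

lemma norm_ell2_tensor: "norm (x \<otimes>\<^sub>2 h) = norm x * norm h"
proof -
  have "complex_of_real ((norm (x \<otimes>\<^sub>2 h))\<^sup>2) = of_real ((norm x * norm h)\<^sup>2)"
    by (simp only: cinner_self[symmetric] cinner_ell2_tensor power_mult_distrib of_real_mult)
  then show ?thesis unfolding of_real_eq_iff by (simp add: power2_eq_iff_nonneg)
qed

interpretation ell2_tensor: bounded_bilinear
  "ell2_tensor :: ('i, complex) ell2 \<Rightarrow> 'h \<Rightarrow> ('i, 'h::complex_inner) ell2"
proof
  fix x y :: "('i, complex) ell2" and h k :: 'h and r :: real
  show "(x + y) \<otimes>\<^sub>2 h = x \<otimes>\<^sub>2 h + y \<otimes>\<^sub>2 h" "x \<otimes>\<^sub>2 (h + k) = x \<otimes>\<^sub>2 h + x \<otimes>\<^sub>2 k"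
    by (rule ell2_eqI, simp add: ell2_tensor.rep_eq plus_ell2.rep_eq scaleC_add_left scaleC_add_right)+
  show "(r *\<^sub>R x) \<otimes>\<^sub>2 h = r *\<^sub>R (x \<otimes>\<^sub>2 h)" "x \<otimes>\<^sub>2 (r *\<^sub>R h) = r *\<^sub>R (x \<otimes>\<^sub>2 h)"
    by (simp_all only: scaleC_of_real[symmetric] ell2_tensor_scaleC_left ell2_tensor_scaleC_right)
  show "\<exists>K. \<forall>(a::('i, complex) ell2) (b::'h). norm (a \<otimes>\<^sub>2 b) \<le> norm a * norm b * K"
    by (rule exI[of _ 1]) (simp add: norm_ell2_tensor)
qed

lemma Rep_fock_basis_tensor: "Rep_ell2 (fock_basis \<alpha> \<otimes>\<^sub>2 h) \<beta> = (if \<beta> = \<alpha> then h else 0)"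
  by (simp add: ell2_tensor.rep_eq fock_basis.rep_eq scaleC_one scaleC.zero_left)

lemma sum_Rep_ell2: "Rep_ell2 (sum x I) i = (\<Sum>j\<in>I. Rep_ell2 (x j) i)"
  by (induction I rule: infinite_finite_induct) (simp_all add: zero_ell2.rep_eq plus_ell2.rep_eq)

lemma Rep_fock_partial_sum:
  "finite F \<Longrightarrow> Rep_ell2 (\<Sum>\<alpha>\<in>F. fock_basis \<alpha> \<otimes>\<^sub>2 v \<alpha>) \<beta> = (if \<beta> \<in> F then v \<beta> else 0)"
  by (simp add: sum_Rep_ell2 Rep_fock_basis_tensor)

lemma norm_fock_partial_sum:
  assumes "finite F"
  shows "(norm (\<Sum>\<alpha>\<in>F. fock_basis \<alpha> \<otimes>\<^sub>2 v \<alpha>))\<^sup>2 = (\<Sum>\<alpha>\<in>F. (norm (v \<alpha>))\<^sup>2)"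
proof -
  have "((\<lambda>\<beta>. (norm (if \<beta> \<in> F then v \<beta> else 0))\<^sup>2) has_sum (\<Sum>\<alpha>\<in>F. (norm (v \<alpha>))\<^sup>2)) UNIV"
    by (rule has_sum_finite_neutralI[OF assms]) auto
  then show ?thesis by (simp add: norm_ell2_square Rep_fock_partial_sum[OF assms] infsumI)
qed

lemma summable_Rep_ell2: "(\<lambda>i. (norm (Rep_ell2 v i))\<^sup>2) summable_on UNIV"
  using Rep_ell2[of v] by simp

text \<open>By Pythagoras the squared distance from \<open>v\<close> to its partial sum over
  \<open>F\<close> is the part of \<open>(norm v)\<^sup>2\<close> carried by the words outside
  \<open>F\<close>, which tends to 0.\<close>

lemma has_sum_fock:
  fixes v :: "('n list, 'h::complex_inner) ell2"
  shows "((\<lambda>\<alpha>. fock_basis \<alpha> \<otimes>\<^sub>2 Rep_ell2 v \<alpha>) has_sum v) UNIV"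
proof -
  let ?S = "\<lambda>F. \<Sum>\<alpha>\<in>F. fock_basis \<alpha> \<otimes>\<^sub>2 Rep_ell2 v \<alpha>"
  let ?s = "\<lambda>F. \<Sum>\<alpha>\<in>F. (norm (Rep_ell2 v \<alpha>))\<^sup>2"
  have sq: "(norm (?S F - v))\<^sup>2 = (norm v)\<^sup>2 - ?s F" if F: "finite F" for F
  proof -
    have "cinner (?S F) v = (\<Sum>\<alpha>\<in>F. cinner (fock_basis \<alpha> \<otimes>\<^sub>2 Rep_ell2 v \<alpha>) v)"
      by (rule cinner.sum_left)
    also have "\<dots> = (\<Sum>\<alpha>\<in>F. of_real ((norm (Rep_ell2 v \<alpha>))\<^sup>2))"
    proof (rule sum.cong)
      fix \<alpha>
      have "((\<lambda>\<beta>. cinner (Rep_ell2 (fock_basis \<alpha> \<otimes>\<^sub>2 Rep_ell2 v \<alpha>) \<beta>) (Rep_ell2 v \<beta>))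
          has_sum of_real ((norm (Rep_ell2 v \<alpha>))\<^sup>2)) UNIV"
        by (rule has_sum_finite_neutralI[of "{\<alpha>}"])
           (auto simp: Rep_fock_basis_tensor cinner_self cinner.zero_left)
      then show "cinner (fock_basis \<alpha> \<otimes>\<^sub>2 Rep_ell2 v \<alpha>) v = of_real ((norm (Rep_ell2 v \<alpha>))\<^sup>2)"
        by (simp only: cinner_ell2.rep_eq infsumI)
    qed simp
    finally have "inner (?S F) v = ?s F"
      by (simp only: Re_cinner[symmetric] of_real_sum[symmetric] Re_complex_of_real)
    then show ?thesis
      using norm_fock_partial_sum[OF F, of "Rep_ell2 v"]
      by (simp add: power2_norm_eq_inner inner_diff_left inner_diff_right inner_commute)
  qed
  have "(?s \<longlongrightarrow> (norm v)\<^sup>2) (finite_subsets_at_top UNIV)"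
    using has_sum_infsum[OF summable_Rep_ell2[of v]] by (simp add: has_sum_def norm_ell2_square)
  then have "((\<lambda>F. sqrt ((norm v)\<^sup>2 - ?s F)) \<longlongrightarrow> sqrt ((norm v)\<^sup>2 - (norm v)\<^sup>2)) (finite_subsets_at_top UNIV)"
    by (intro tendsto_intros)
  moreover have "\<forall>\<^sub>F F in finite_subsets_at_top UNIV. sqrt ((norm v)\<^sup>2 - ?s F) = norm (?S F - v)"
    by (rule eventually_finite_subsets_at_top_weakI) (simp add: sq[symmetric])
  ultimately have "((\<lambda>F. norm (?S F - v)) \<longlongrightarrow> 0) (finite_subsets_at_top UNIV)"
    by (simp add: tendsto_cong)
  then show ?thesis
    unfolding has_sum_def by (simp add: LIM_zero_cancel tendsto_norm_zero_iff)
qed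

lemma has_sum_fock_complex:
  "((\<lambda>\<alpha>. Rep_ell2 x \<alpha> *\<^sub>C fock_basis \<alpha>) has_sum (x :: 'n fock)) UNIV"
proof -
  have "fock_basis \<alpha> \<otimes>\<^sub>2 c = c *\<^sub>C fock_basis \<alpha>" for \<alpha> :: "'n list" and c :: complex
    by (rule ell2_eqI) (simp add: ell2_tensor.rep_eq scaleC_ell2.rep_eq scaleC_complex_def)
  then show ?thesis using has_sum_fock[of x] by simp
qed

text \<open>A Cauchy criterion for unordered series that need not converge absolutely: the tails are
  controlled by those of \<open>p\<close>. With \<open>p\<close> the squared norms of the
  coefficients it yields the convergence of the series for \<open>A \<otimes> I\<close>.\<close>

lemma summable_on_square_bound:
  fixes f :: "'i \<Rightarrow> 'a::banach"
  assumes p: "p summable_on UNIV" "\<And>i. 0 \<le> p i"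
    and bound: "\<And>F. finite F \<Longrightarrow> (norm (sum f F))\<^sup>2 \<le> C * sum p F"
  shows "f summable_on UNIV" "(norm (infsum f UNIV))\<^sup>2 \<le> C * infsum p UNIV"
proof -
  have "cauchy_filter (filtermap (sum f) (finite_subsets_at_top UNIV))"
    unfolding cauchy_filter_metric_filtermap
  proof (intro allI impI)
    fix e :: real assume "e > 0"
    \<comment> \<open>Chosen so that \<open>(\<bar>C\<bar> + 1) * d = (e / 2)\<^sup>2\<close>; the
      added 1 keeps the denominator positive whatever \<open>C\<close> is.\<close>
    define d where "d = (e / 2)\<^sup>2 / (\<bar>C\<bar> + 1)"
    have "d > 0" using \<open>e > 0\<close> by (auto simp: d_def intro!: divide_pos_pos)
    have "(sum p \<longlongrightarrow> infsum p UNIV) (finite_subsets_at_top UNIV)"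
      using has_sum_infsum[OF p(1)] by (simp add: has_sum_def)
    then have "\<forall>\<^sub>F F in finite_subsets_at_top UNIV. dist (sum p F) (infsum p UNIV) < d"
      using \<open>d > 0\<close> by (rule tendstoD)
    then obtain F0 where F0: "finite F0" "dist (sum p F0) (infsum p UNIV) < d"
      unfolding eventually_finite_subsets_at_top by blast
    have close: "dist (sum f F) (sum f F0) < e / 2" if F: "finite F" "F0 \<subseteq> F" for F
    proof -
      have "sum p F \<le> infsum p UNIV" using F p by (intro finite_sum_le_infsum) auto
      then have "sum p (F - F0) < d"
        using F0(2) by (simp add: sum_diff[OF F] dist_real_def)
      have "0 \<le> sum p (F - F0)" by (intro sum_nonneg p(2))
      then have "C * sum p (F - F0) \<le> (\<bar>C\<bar> + 1) * sum p (F - F0)"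
        by (intro mult_right_mono) auto
      moreover have "(\<bar>C\<bar> + 1) * sum p (F - F0) < (\<bar>C\<bar> + 1) * d"
        using \<open>sum p (F - F0) < d\<close> by (intro mult_strict_left_mono) auto
      ultimately have "C * sum p (F - F0) < (\<bar>C\<bar> + 1) * d" by linarith
      then have "(norm (sum f (F - F0)))\<^sup>2 < (e / 2)\<^sup>2"
        using bound[of "F - F0"] F by (simp add: d_def)
      then have "norm (sum f (F - F0)) < e / 2"
        by (rule power_less_imp_less_base) (use \<open>e > 0\<close> in simp)
      then show ?thesis by (simp add: dist_norm sum_diff[OF F])
    qed
    have "dist (sum f F) (sum f G) < e" if "finite F" "F0 \<subseteq> F" "finite G" "F0 \<subseteq> G" for F G
      using dist_triangle2[of "sum f F" "sum f G" "sum f F0"] close[of F] close[of G] that by simp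
    moreover have "\<forall>\<^sub>F F in finite_subsets_at_top UNIV. finite F \<and> F0 \<subseteq> F"
      using F0(1) unfolding eventually_finite_subsets_at_top by blast
    ultimately show "\<exists>P. eventually P (finite_subsets_at_top UNIV) \<and>
        (\<forall>F G. P F \<and> P G \<longrightarrow> dist (sum f F) (sum f G) < e)"
      by (intro exI[of _ "\<lambda>F. finite F \<and> F0 \<subseteq> F"]) auto
  qed
  moreover have "complete (UNIV :: 'a set)"
    by (meson Cauchy_convergent UNIV_I complete_def convergent_def)
  ultimately obtain L where "(sum f \<longlongrightarrow> L) (finite_subsets_at_top UNIV)"
    using complete_uniform[where S = UNIV] by (force simp: filterlim_def)
  then show f: "f summable_on UNIV" by (auto simp: summable_on_def has_sum_def)
  show "(norm (infsum f UNIV))\<^sup>2 \<le> C * infsum p UNIV"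
  proof (rule tendsto_le)
    show "((\<lambda>F. (norm (sum f F))\<^sup>2) \<longlongrightarrow> (norm (infsum f UNIV))\<^sup>2) (finite_subsets_at_top UNIV)"
      using has_sum_infsum[OF f] by (intro tendsto_intros) (simp add: has_sum_def)
    show "((\<lambda>F. C * sum p F) \<longlongrightarrow> C * infsum p UNIV) (finite_subsets_at_top UNIV)"
      using has_sum_infsum[OF p(1)] by (intro tendsto_intros) (simp add: has_sum_def)
  qed (auto intro!: eventually_finite_subsets_at_top_weakI bound)
qed

text \<open>The same \<open>x\<close> and \<open>e\<close> serve all \<open>S\<close> at once. In
  these coordinates \<open>S \<otimes> I\<close> acts as \<open>S\<close> on each
  \<open>x l\<close>, and comparing a given \<open>S\<close> with the identity transfers norm bounds
  and positivity from \<open>S\<close> to \<open>S \<otimes> I\<close> on finite sums.\<close>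

lemma tensor_decomposition:
  fixes v :: "'n list \<Rightarrow> 'h::complex_inner"
  assumes F: "finite F"
  obtains A :: "'n list set" and e :: "'n list \<Rightarrow> 'h" and x :: "'n list \<Rightarrow> 'n fock"
  where "finite A" "orthonormal_on A e"
    "\<And>S :: 'n fock \<Rightarrow>\<^sub>L 'n fock. S \<in> bops \<Longrightarrow>
      (\<Sum>\<alpha>\<in>F. blinfun_apply S (fock_basis \<alpha>) \<otimes>\<^sub>2 v \<alpha>) = (\<Sum>l\<in>A. blinfun_apply S (x l) \<otimes>\<^sub>2 e l)"
proof -
  obtain A e c where A: "A \<subseteq> F" "orthonormal_on A e"
    and c: "\<And>i. i \<in> F \<Longrightarrow> v i = (\<Sum>l\<in>A. c i l *\<^sub>C e l)"
    using orthonormal_coefficients[OF F, of v] by blast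
  have "(\<Sum>\<alpha>\<in>F. blinfun_apply S (fock_basis \<alpha>) \<otimes>\<^sub>2 v \<alpha>) =
      (\<Sum>l\<in>A. blinfun_apply S (\<Sum>\<alpha>\<in>F. c \<alpha> l *\<^sub>C fock_basis \<alpha>) \<otimes>\<^sub>2 e l)"
    if S: "S \<in> bops" for S :: "'n fock \<Rightarrow>\<^sub>L 'n fock"
  proof -
    have "(\<Sum>\<alpha>\<in>F. blinfun_apply S (fock_basis \<alpha>) \<otimes>\<^sub>2 v \<alpha>) =
        (\<Sum>\<alpha>\<in>F. \<Sum>l\<in>A. c \<alpha> l *\<^sub>C (blinfun_apply S (fock_basis \<alpha>) \<otimes>\<^sub>2 e l))"
      by (intro sum.cong refl) (simp add: c ell2_tensor.sum_right ell2_tensor_scaleC_right)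
    also have "\<dots> = (\<Sum>l\<in>A. \<Sum>\<alpha>\<in>F. c \<alpha> l *\<^sub>C (blinfun_apply S (fock_basis \<alpha>) \<otimes>\<^sub>2 e l))"
      by (rule sum.swap)
    finally show ?thesis
      by (simp add: blinfun.sum_right bopsD[OF S] ell2_tensor.sum_left ell2_tensor_scaleC_left)
  qed
  moreover have "finite A" using A(1) F finite_subset by blast
  ultimately show ?thesis using A(2) by (intro that)
qed

lemma cinner_orthonormal_tensor_sum:
  assumes "orthonormal_on A e" "finite A"
  shows "cinner (\<Sum>l\<in>A. x l \<otimes>\<^sub>2 e l) (\<Sum>l\<in>A. y l \<otimes>\<^sub>2 e l) = (\<Sum>l\<in>A. cinner (x l) (y l))"
proof -
  have "cinner (\<Sum>l\<in>A. x l \<otimes>\<^sub>2 e l) (\<Sum>l\<in>A. y l \<otimes>\<^sub>2 e l) =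
      (\<Sum>l\<in>A. \<Sum>k\<in>A. cinner (x l) (y k) * cinner (e l) (e k))"
    by (simp only: cinner.sum_left, simp only: cinner.sum_right cinner_ell2_tensor)
  also have "\<dots> = (\<Sum>l\<in>A. \<Sum>k\<in>A. if k = l then cinner (x l) (y l) else 0)"
    using assms(1) by (intro sum.cong) (auto simp: orthonormal_on_def)
  finally show ?thesis using assms(2) by simp
qed

lemma norm_tensor_sum_le:
  fixes v :: "'n list \<Rightarrow> 'h::complex_inner" and S :: "'n fock \<Rightarrow>\<^sub>L 'n fock"
  assumes S: "S \<in> bops" and F: "finite F"
  shows "(norm (\<Sum>\<alpha>\<in>F. blinfun_apply S (fock_basis \<alpha>) \<otimes>\<^sub>2 v \<alpha>))\<^sup>2 \<le> (norm S)\<^sup>2 * (\<Sum>\<alpha>\<in>F. (norm (v \<alpha>))\<^sup>2)"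
proof -
  obtain A :: "'n list set" and e :: "'n list \<Rightarrow> 'h" and x :: "'n list \<Rightarrow> 'n fock"
    where A: "finite A" "orthonormal_on A e" and
    dec: "\<And>S :: 'n fock \<Rightarrow>\<^sub>L 'n fock. S \<in> bops \<Longrightarrow>
      (\<Sum>\<alpha>\<in>F. blinfun_apply S (fock_basis \<alpha>) \<otimes>\<^sub>2 v \<alpha>) = (\<Sum>l\<in>A. blinfun_apply S (x l) \<otimes>\<^sub>2 e l)"
    by (rule tensor_decomposition[OF F, of v]) blast
  have norm_eq: "(norm (\<Sum>l\<in>A. y l \<otimes>\<^sub>2 e l))\<^sup>2 = (\<Sum>l\<in>A. (norm (y l))\<^sup>2)" for y :: "'n list \<Rightarrow> 'n fock"
    using cinner_orthonormal_tensor_sum[OF A(2,1), of y y]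
    unfolding cinner_self of_real_sum[symmetric] of_real_eq_iff .
  have "(norm (\<Sum>\<alpha>\<in>F. blinfun_apply S (fock_basis \<alpha>) \<otimes>\<^sub>2 v \<alpha>))\<^sup>2 = (\<Sum>l\<in>A. (norm (blinfun_apply S (x l)))\<^sup>2)"
    unfolding dec[OF S] by (rule norm_eq)
  also have "\<dots> \<le> (\<Sum>l\<in>A. (norm S)\<^sup>2 * (norm (x l))\<^sup>2)"
    unfolding power_mult_distrib[symmetric] by (intro sum_mono power_mono norm_blinfun norm_ge_zero)
  also have "\<dots> = (norm S)\<^sup>2 * (norm (\<Sum>l\<in>A. x l \<otimes>\<^sub>2 e l))\<^sup>2"
    unfolding norm_eq by (rule sum_distrib_left[symmetric])
  also have "(\<Sum>l\<in>A. x l \<otimes>\<^sub>2 e l) = (\<Sum>\<alpha>\<in>F. fock_basis \<alpha> \<otimes>\<^sub>2 v \<alpha>)"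
    using dec[OF bops_id] by simp
  finally show ?thesis by (simp only: norm_fock_partial_sum[OF F])
qed

text \<open>Elementary tensors are total by \<open>has_sum_fock\<close>. The uniqueness of
  \<open>A \<otimes> I\<close> and its rules for sums and adjoints are all reduced to them this
  way.\<close>

lemma ell2_tensor_total:
  fixes f g :: "('n list, 'h::complex_inner) ell2 \<Rightarrow> 'b::real_normed_vector"
  assumes "bounded_linear f" "bounded_linear g" "\<And>x h. f (x \<otimes>\<^sub>2 h) = g (x \<otimes>\<^sub>2 h)"
  shows "f v = g v"
  using has_sum_bounded_linear[OF assms(1) has_sum_fock[of v]]
    has_sum_bounded_linear[OF assms(2) has_sum_fock[of v]] has_sum_unique
  by (simp add: assms(3)) blast

section \<open>The operator \<open>A \<otimes> I\<close>\<close>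

lemma tensor_id_op_eqI:
  fixes T :: "('n list, 'h::complex_inner) ell2 \<Rightarrow>\<^sub>L ('n list, 'h) ell2"
  assumes "\<And>x h. blinfun_apply T (x \<otimes>\<^sub>2 h) = blinfun_apply A x \<otimes>\<^sub>2 h"
  shows "tensor_id_op A = T"
  unfolding tensor_id_op_def
proof (rule the_equality)
  fix T' :: "('n list, 'h) ell2 \<Rightarrow>\<^sub>L ('n list, 'h) ell2" assume T': "\<forall>x h. blinfun_apply T' (x \<otimes>\<^sub>2 h) = blinfun_apply A x \<otimes>\<^sub>2 h"
  show "T' = T"
    by (rule blinfun_eqI, rule ell2_tensor_total)
       (auto simp: assms T' blinfun.bounded_linear_right)
qed (use assms in blast)

text \<open>The operator is built column by column, as the sum of the images of the basis words
  tensored with the coefficients of \<open>v\<close>; \<open>norm_tensor_sum_le\<close> gives both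
  the convergence and the bound \<open>norm A\<close>.\<close>

lemma tensor_id_op_exists:
  fixes A :: "'n fock \<Rightarrow>\<^sub>L 'n fock"
  assumes A: "A \<in> bops"
  shows "\<exists>T :: ('n list, 'h::chilbert_space) ell2 \<Rightarrow>\<^sub>L ('n list, 'h) ell2.
    \<forall>x h. blinfun_apply T (x \<otimes>\<^sub>2 h) = blinfun_apply A x \<otimes>\<^sub>2 h"
proof -
  define t where "t v \<alpha> = blinfun_apply A (fock_basis \<alpha>) \<otimes>\<^sub>2 Rep_ell2 v \<alpha>"
    for v :: "('n list, 'h) ell2" and \<alpha>
  define T where "T v = infsum (t v) UNIV" for v
  have bound: "t v summable_on UNIV"
      "(norm (infsum (t v) UNIV))\<^sup>2 \<le> (norm A)\<^sup>2 * (\<Sum>\<^sub>\<infinity>\<alpha>. (norm (Rep_ell2 v \<alpha>))\<^sup>2)" for v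
    unfolding t_def
    by (rule summable_on_square_bound[OF summable_Rep_ell2[of v] zero_le_power2 norm_tensor_sum_le[OF A]];
        assumption)+
  have t: "(t v has_sum T v) UNIV" for v
    unfolding T_def by (rule has_sum_infsum) (rule bound)
  have "bounded_linear T"
  proof (rule bounded_linear_intro[where K = "norm A"])
    fix v w :: "('n list, 'h) ell2" and r :: real
    have "t (v + w) = (\<lambda>\<alpha>. t v \<alpha> + t w \<alpha>)" "t (r *\<^sub>R v) = (\<lambda>\<alpha>. r *\<^sub>R t v \<alpha>)"
      by (simp_all add: t_def fun_eq_iff plus_ell2.rep_eq scaleR_ell2.rep_eq ell2_tensor.add_right
          ell2_tensor.scaleR_right)
    then show "T (v + w) = T v + T w" "T (r *\<^sub>R v) = r *\<^sub>R T v"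
      using has_sum_add[OF t[of v] t[of w]] has_sum_bounded_linear[OF bounded_linear_scaleR_right t[of v], of r]
        t[of "v + w"] t[of "r *\<^sub>R v"] has_sum_unique by metis+
    have "(norm (T v))\<^sup>2 \<le> (norm v * norm A)\<^sup>2"
      using bound(2)[of v] by (simp add: T_def norm_ell2_square[of v, symmetric] power_mult_distrib mult.commute)
    then show "norm (T v) \<le> norm v * norm A"
      by (rule power2_le_imp_le) simp
  qed
  moreover have "T (x \<otimes>\<^sub>2 h) = blinfun_apply A x \<otimes>\<^sub>2 h" for x h
  proof (rule has_sum_unique[OF t])
    have "((\<lambda>\<alpha>. blinfun_apply A (Rep_ell2 x \<alpha> *\<^sub>C fock_basis \<alpha>) \<otimes>\<^sub>2 h) has_sum blinfun_apply A x \<otimes>\<^sub>2 h) UNIV"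
      by (intro has_sum_bounded_linear[OF ell2_tensor.bounded_linear_left]
          has_sum_bounded_linear[OF blinfun.bounded_linear_right] has_sum_fock_complex)
    then show "(t (x \<otimes>\<^sub>2 h) has_sum blinfun_apply A x \<otimes>\<^sub>2 h) UNIV"
      by (simp add: t_def[abs_def] ell2_tensor.rep_eq bopsD[OF A] ell2_tensor_scaleC_left ell2_tensor_scaleC_right)
  qed
  ultimately show ?thesis
    by (intro exI[of _ "Blinfun T"]) (simp add: bounded_linear_Blinfun_apply)
qed

lemma tensor_id_op_apply:
  fixes A :: "'n fock \<Rightarrow>\<^sub>L 'n fock"
  assumes "A \<in> bops"
  shows "blinfun_apply (tensor_id_op A) (x \<otimes>\<^sub>2 (h::'h::chilbert_space)) = blinfun_apply A x \<otimes>\<^sub>2 h"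
  using tensor_id_op_exists[OF assms] tensor_id_op_eqI by metis

lemma bops_tensor_id_op [simp]:
  assumes "A \<in> bops"
  shows "(tensor_id_op A :: ('n list, 'h::chilbert_space) ell2 \<Rightarrow>\<^sub>L ('n list, 'h) ell2) \<in> bops"
  unfolding bops_def
proof (intro CollectI allI)
  fix c and v :: "('n list, 'h) ell2"
  show "blinfun_apply (tensor_id_op A) (c *\<^sub>C v) = c *\<^sub>C blinfun_apply (tensor_id_op A) v"
  proof (rule ell2_tensor_total[of "\<lambda>v. blinfun_apply (tensor_id_op A) (c *\<^sub>C v)"
        "\<lambda>v. c *\<^sub>C blinfun_apply (tensor_id_op A) v"])
  show "bounded_linear (\<lambda>v. blinfun_apply (tensor_id_op A) (c *\<^sub>C v :: ('n list, 'h) ell2))"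
    by (intro bounded_linear_compose[OF blinfun.bounded_linear_right] bounded_linear_scaleC)
  show "bounded_linear (\<lambda>v. c *\<^sub>C blinfun_apply (tensor_id_op A) (v :: ('n list, 'h) ell2))"
    by (intro bounded_linear_compose[OF bounded_linear_scaleC] blinfun.bounded_linear_right)
  show "blinfun_apply (tensor_id_op A) (c *\<^sub>C (x \<otimes>\<^sub>2 h)) = c *\<^sub>C blinfun_apply (tensor_id_op A) (x \<otimes>\<^sub>2 (h::'h))"
    for x h
    by (simp only: ell2_tensor_scaleC_left[symmetric] tensor_id_op_apply[OF assms] bopsD[OF assms])
  qed
qed

lemma tensor_id_op_add:
  assumes "A \<in> bops" "B \<in> bops"
  shows "(tensor_id_op (A + B) :: ('n list, 'h::chilbert_space) ell2 \<Rightarrow>\<^sub>L _) = tensor_id_op A + tensor_id_op B"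
  by (rule tensor_id_op_eqI) (simp add: tensor_id_op_apply assms blinfun.add_left ell2_tensor.add_left)

lemma tensor_id_op_adj:
  fixes A :: "'n fock \<Rightarrow>\<^sub>L 'n fock"
  assumes "A \<in> bops"
  shows "(tensor_id_op (adj A) :: ('n list, 'h::chilbert_space) ell2 \<Rightarrow>\<^sub>L _) = adj (tensor_id_op A)"
proof (rule adjI[symmetric])
  fix v w :: "('n list, 'h) ell2"
  note bl = bounded_linear_compose[OF cinner.bounded_linear_left blinfun.bounded_linear_right]
    bounded_linear_compose[OF cinner.bounded_linear_right blinfun.bounded_linear_right]
    cinner.bounded_linear_left cinner.bounded_linear_right
  \<comment> \<open>Totality is used once in each argument: here in \<open>w\<close> with an
    elementary tensor on the left, afterwards in \<open>v\<close>.\<close>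
  have "cinner (blinfun_apply (tensor_id_op A) (x \<otimes>\<^sub>2 h)) w = cinner (x \<otimes>\<^sub>2 h) (blinfun_apply (tensor_id_op (adj A)) w)"
    for x and h :: 'h
    by (rule ell2_tensor_total[OF bl(4) bl(2)])
       (simp add: tensor_id_op_apply assms cinner_ell2_tensor cinner_adj_right)
  then show "cinner (blinfun_apply (tensor_id_op A) v) w = cinner v (blinfun_apply (tensor_id_op (adj A)) w)"
    by (rule ell2_tensor_total[OF bl(1) bl(3)])
qed

text \<open>Serves both implications: for \<open>tensor_id_op A\<close> with coefficients in the
  Hilbert space, and for the symbol itself with scalar coefficients, where it leaves only finitely
  supported vectors.\<close>

lemma positive_on_partial_sums:
  fixes v :: "('n list, 'h::complex_inner) ell2"
  assumes "\<And>F. finite F \<Longrightarrow> cinner (blinfun_apply T (\<Sum>\<alpha>\<in>F. fock_basis \<alpha> \<otimes>\<^sub>2 Rep_ell2 v \<alpha>))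
    (\<Sum>\<alpha>\<in>F. fock_basis \<alpha> \<otimes>\<^sub>2 Rep_ell2 v \<alpha>) \<in> \<real>\<^sub>\<ge>\<^sub>0"
  shows "cinner (blinfun_apply T v) v \<in> \<real>\<^sub>\<ge>\<^sub>0"
proof (rule Lim_in_closed_set[OF closed_nonneg_Reals_complex])
  let ?S = "\<lambda>F. \<Sum>\<alpha>\<in>F. fock_basis \<alpha> \<otimes>\<^sub>2 Rep_ell2 v \<alpha>"
  show "\<forall>\<^sub>F F in finite_subsets_at_top UNIV. cinner (blinfun_apply T (?S F)) (?S F) \<in> \<real>\<^sub>\<ge>\<^sub>0"
    by (rule eventually_finite_subsets_at_top_weakI) (rule assms)
  have "(?S \<longlongrightarrow> v) (finite_subsets_at_top UNIV)"
    using has_sum_fock[of v] by (simp add: has_sum_def)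
  then show "((\<lambda>F. cinner (blinfun_apply T (?S F)) (?S F)) \<longlongrightarrow> cinner (blinfun_apply T v) v)
      (finite_subsets_at_top UNIV)"
    by (intro cinner.tendsto blinfun.tendsto tendsto_const)
qed simp

text \<open>In the coordinates of \<open>tensor_decomposition\<close> the form of
  \<open>A \<otimes> I\<close> is a finite sum of values of the form of \<open>A\<close>.\<close>

lemma tensor_id_op_nonneg:
  fixes v :: "('n list, 'h::chilbert_space) ell2"
  assumes A: "positive_op A"
  shows "cinner (blinfun_apply (tensor_id_op A) v) v \<in> \<real>\<^sub>\<ge>\<^sub>0"
proof (rule positive_on_partial_sums)
  fix F :: "'n list set" assume F: "finite F"
  have A': "A \<in> bops" using A by (simp add: positive_op_def)
  obtain B :: "'n list set" and e :: "'n list \<Rightarrow> 'h" and x :: "'n list \<Rightarrow> 'n fock"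
    where B: "finite B" "orthonormal_on B e" and
    dec: "\<And>S :: 'n fock \<Rightarrow>\<^sub>L 'n fock. S \<in> bops \<Longrightarrow>
      (\<Sum>\<alpha>\<in>F. blinfun_apply S (fock_basis \<alpha>) \<otimes>\<^sub>2 Rep_ell2 v \<alpha>) = (\<Sum>l\<in>B. blinfun_apply S (x l) \<otimes>\<^sub>2 e l)"
    by (rule tensor_decomposition[OF F, of "Rep_ell2 v"]) blast
  have S: "(\<Sum>\<alpha>\<in>F. fock_basis \<alpha> \<otimes>\<^sub>2 Rep_ell2 v \<alpha>) = (\<Sum>l\<in>B. x l \<otimes>\<^sub>2 e l)"
    using dec[OF bops_id] by simp
  show "cinner (blinfun_apply (tensor_id_op A) (\<Sum>\<alpha>\<in>F. fock_basis \<alpha> \<otimes>\<^sub>2 Rep_ell2 v \<alpha>))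
      (\<Sum>\<alpha>\<in>F. fock_basis \<alpha> \<otimes>\<^sub>2 Rep_ell2 v \<alpha>) \<in> \<real>\<^sub>\<ge>\<^sub>0"
    using A by (simp add: S blinfun.sum_right tensor_id_op_apply[OF A'] cinner_orthonormal_tensor_sum[OF B(2,1)]
        positive_op_def complex_nonneg_Reals_iff sum_nonneg)
qed

subsection \<open>Left multiplication operators\<close>

lemma left_mult_eqI: "is_left_mult g S \<Longrightarrow> left_mult g = S"
  unfolding left_mult_def
  by (rule the_equality) (auto simp: is_left_mult_def intro!: blinfun_eqI ell2_eqI)

lemma Rep_left_mult:
  assumes "g \<in> F_infinity"
  shows "Rep_ell2 (blinfun_apply (left_mult g) x) = fock_mult_coeff g x"
proof -
  obtain S where S: "is_left_mult g S" using assms by (auto simp: F_infinity_def)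
  show ?thesis using S unfolding left_mult_eqI[OF S] is_left_mult_def by blast
qed

lemma bops_left_mult [simp]:
  assumes "g \<in> F_infinity"
  shows "left_mult g \<in> bops"
  unfolding bops_def
  by (intro CollectI allI, rule ell2_eqI)
     (simp add: Rep_left_mult[OF assms] scaleC_ell2.rep_eq fock_mult_coeff_def scaleC_complex_def
       sum_distrib_left case_prod_unfold mult.left_commute)

text \<open>A word ends in \<open>\<beta>\<close> in at most one way, so at most one factorisation
  survives in \<open>fock_mult_coeff\<close>.\<close>

lemma Rep_left_mult_basis:
  assumes "g \<in> F_infinity"
  shows "Rep_ell2 (blinfun_apply (left_mult g) (fock_basis \<beta>)) (\<alpha> @ \<beta>) = Rep_ell2 g \<alpha>"
    and "\<gamma> \<notin> range (\<lambda>\<alpha>. \<alpha> @ \<beta>) \<Longrightarrow> Rep_ell2 (blinfun_apply (left_mult g) (fock_basis \<beta>)) \<gamma> = 0"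
proof -
  \<comment> \<open>A factorisation is a cut position. Finiteness matters because \<open>sum\<close>
    over an infinite set would be 0.\<close>
  have fin: "finite {(\<alpha>, \<beta>). \<alpha> @ \<beta> = \<gamma>}" for \<gamma> :: "'a list"
  proof (rule finite_subset)
    show "{(\<alpha>, \<beta>). \<alpha> @ \<beta> = \<gamma>} \<subseteq> (\<lambda>k. (take k \<gamma>, drop k \<gamma>)) ` {..length \<gamma>}"
    proof clarify
      fix \<alpha> \<beta> :: "'a list"
      show "(\<alpha>, \<beta>) \<in> (\<lambda>k. (take k (\<alpha> @ \<beta>), drop k (\<alpha> @ \<beta>))) ` {..length (\<alpha> @ \<beta>)}"
        by (rule image_eqI[of _ _ "length \<alpha>"]) auto
    qed
  qed simp
  show "Rep_ell2 (blinfun_apply (left_mult g) (fock_basis \<beta>)) (\<alpha> @ \<beta>) = Rep_ell2 g \<alpha>"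
  proof -
    have "(\<Sum>(\<alpha>', \<beta>')\<in>{(\<alpha>', \<beta>'). \<alpha>' @ \<beta>' = \<alpha> @ \<beta>}. Rep_ell2 g \<alpha>' * Rep_ell2 (fock_basis \<beta>) \<beta>') =
        (\<Sum>(\<alpha>', \<beta>')\<in>{(\<alpha>, \<beta>)}. Rep_ell2 g \<alpha>' * Rep_ell2 (fock_basis \<beta>) \<beta>')"
      by (rule sum.mono_neutral_right[OF fin]) (auto simp: fock_basis.rep_eq split: if_splits)
    then show ?thesis
      by (simp add: Rep_left_mult[OF assms] fock_mult_coeff_def fock_basis.rep_eq)
  qed
  show "Rep_ell2 (blinfun_apply (left_mult g) (fock_basis \<beta>)) \<gamma> = 0" if "\<gamma> \<notin> range (\<lambda>\<alpha>. \<alpha> @ \<beta>)"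
    using that unfolding Rep_left_mult[OF assms] fock_mult_coeff_def
    by (intro sum.neutral) (auto simp: fock_basis.rep_eq)
qed

text \<open>The pairing runs over all words, but the coefficients vanish off the words ending in
  \<open>\<beta>\<close>; deleting that ending reindexes it by \<open>\<alpha>\<close>. These are
  the column sums of the double series for the Poisson transform.\<close>

lemma has_sum_left_mult_basis:
  fixes w :: "('n list, 'h::complex_inner) ell2"
  assumes "g \<in> F_infinity"
  shows "((\<lambda>\<alpha>. Rep_ell2 g \<alpha> * cinner k (Rep_ell2 w (\<alpha> @ \<beta>))) has_sum
    cinner (blinfun_apply (left_mult g) (fock_basis \<beta>) \<otimes>\<^sub>2 k) w) UNIV"
proof -
  let ?y = "blinfun_apply (left_mult g) (fock_basis \<beta>)"
  have "((\<lambda>\<gamma>. cinner (Rep_ell2 (?y \<otimes>\<^sub>2 k) \<gamma>) (Rep_ell2 w \<gamma>)) has_sum cinner (?y \<otimes>\<^sub>2 k) w) UNIV"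
    unfolding cinner_ell2.rep_eq
    by (rule has_sum_infsum) (rule ell2_cinner_summable[OF summable_Rep_ell2 summable_Rep_ell2])
  then have "((\<lambda>\<gamma>. Rep_ell2 ?y \<gamma> * cinner k (Rep_ell2 w \<gamma>)) has_sum cinner (?y \<otimes>\<^sub>2 k) w) UNIV"
    by (simp add: ell2_tensor.rep_eq cinner_scaleC_left)
  then have "((\<lambda>\<gamma>. Rep_ell2 ?y \<gamma> * cinner k (Rep_ell2 w \<gamma>)) has_sum cinner (?y \<otimes>\<^sub>2 k) w)
      (range (\<lambda>\<alpha>. \<alpha> @ \<beta>))"
    by (rule has_sum_cong_neutral[THEN iffD1, rotated -1]) (auto simp: Rep_left_mult_basis(2)[OF assms])
  moreover have "inj (\<lambda>\<alpha>. \<alpha> @ \<beta>)" by (auto simp: inj_on_def)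
  ultimately show ?thesis
    by (simp add: has_sum_reindex o_def Rep_left_mult_basis(1)[OF assms])
qed

subsection \<open>The Poisson kernel\<close>

text \<open>The candidate \<open>K\<close> is given by its coefficients, square-summable by
  \<open>has_sum_defect\<close>; its expansion in basis words then identifies it with the series
  inside \<open>Blinfun\<close>.\<close>

lemma poisson_kernel:
  fixes X :: "'n::finite \<Rightarrow> 'h::chilbert_space \<Rightarrow>\<^sub>L 'h"
  assumes X: "X \<in> row_ball"
  shows Rep_poisson_kernel: "Rep_ell2 (blinfun_apply (poisson_kernel X) h) \<alpha> =
      blinfun_apply (defect_op X) (blinfun_apply (adj (word_op X \<alpha>)) h)"
    and norm_poisson_kernel: "norm (blinfun_apply (poisson_kernel X) h) = norm h"
proof -
  define k where "k h \<alpha> = blinfun_apply (defect_op X) (blinfun_apply (adj (word_op X \<alpha>)) h)" for h \<alpha>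
  define K where "K h = Abs_ell2 (k h)" for h
  have sq: "((\<lambda>\<alpha>. (norm (k h \<alpha>))\<^sup>2) has_sum (norm h)\<^sup>2) UNIV" for h
    unfolding k_def by (rule has_sum_defect[OF X])
  have Rep: "Rep_ell2 (K h) = k h" for h
    unfolding K_def using sq[of h] by (intro Abs_ell2_inverse) (auto simp: summable_on_def)
  have norm: "norm (K h) = norm h" for h
    using infsumI[OF sq[of h]] norm_ell2_square[of "K h"] by (simp add: Rep power2_eq_iff_nonneg)
  have "bounded_linear K"
    by (rule bounded_linear_intro[where K = 1], rule ell2_eqI, simp_all add: norm)
       (auto simp: Rep k_def plus_ell2.rep_eq blinfun.add_right
        scaleR_ell2.rep_eq blinfun.scaleR_right intro!: ell2_eqI)
  moreover have "poisson_kernel X = Blinfun K"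
    unfolding poisson_kernel_def k_def[symmetric]
    using infsumI[OF has_sum_fock[of "K h" for h]] by (simp add: Rep)
  ultimately have K: "blinfun_apply (poisson_kernel X) = K"
    by (simp add: bounded_linear_Blinfun_apply)
  show "Rep_ell2 (blinfun_apply (poisson_kernel X) h) \<alpha> =
      blinfun_apply (defect_op X) (blinfun_apply (adj (word_op X \<alpha>)) h)"
    by (simp add: K Rep k_def)
  show "norm (blinfun_apply (poisson_kernel X) h) = norm h" by (simp add: K norm)
qed

lemma bops_poisson_kernel:
  fixes X :: "'n::finite \<Rightarrow> 'h::chilbert_space \<Rightarrow>\<^sub>L 'h"
  assumes X: "X \<in> row_ball"
  shows "poisson_kernel X \<in> bops"
  unfolding bops_def
  by (intro CollectI allI, rule ell2_eqI)
     (simp add: Rep_poisson_kernel[OF X] scaleC_ell2.rep_eq bopsD bops_word_op row_ballD(1)[OF X]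
       defect_op_properties(1)[OF X])

text \<open>Polarization gives the real inner product, and complex linearity of the kernel the
  imaginary part.\<close>

lemma cinner_poisson_kernel:
  fixes X :: "'n::finite \<Rightarrow> 'h::chilbert_space \<Rightarrow>\<^sub>L 'h"
  assumes X: "X \<in> row_ball"
  shows "cinner (blinfun_apply (poisson_kernel X) x) (blinfun_apply (poisson_kernel X) y) = cinner x y"
proof -
  have inner: "inner (blinfun_apply (poisson_kernel X) x) (blinfun_apply (poisson_kernel X) y) = inner x y" for x y
    unfolding dot_norm blinfun.add_right[symmetric] norm_poisson_kernel[OF X] ..
  show ?thesis
    unfolding cinner_eq[of "blinfun_apply _ _"] cinner_eq[of x] inner
      bopsD[OF bops_poisson_kernel[OF X], symmetric] ..
qed

lemma Rep_poisson_kernel_append: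
  fixes X :: "'n::finite \<Rightarrow> 'h::chilbert_space \<Rightarrow>\<^sub>L 'h"
  assumes X: "X \<in> row_ball"
  shows "Rep_ell2 (blinfun_apply (poisson_kernel X) y) (\<alpha> @ \<beta>) =
    Rep_ell2 (blinfun_apply (poisson_kernel X) (blinfun_apply (adj (word_op X \<alpha>)) y)) \<beta>"
  by (simp add: Rep_poisson_kernel[OF X] adj_word_op_append[OF X])

lemma cinner_poisson_transform:
  fixes X :: "'n::finite \<Rightarrow> 'h::chilbert_space \<Rightarrow>\<^sub>L 'h"
  assumes X: "X \<in> row_ball"
  shows "cinner (blinfun_apply (poisson_transform A X) x) y =
    cinner (blinfun_apply (tensor_id_op A) (blinfun_apply (poisson_kernel X) x)) (blinfun_apply (poisson_kernel X) y)"
  by (simp add: poisson_transform_def cinner_adj_left bops_poisson_kernel[OF X])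

lemma bops_poisson_transform:
  fixes X :: "'n::finite \<Rightarrow> 'h::chilbert_space \<Rightarrow>\<^sub>L 'h"
  assumes X: "X \<in> row_ball" and A: "A \<in> bops"
  shows "poisson_transform A X \<in> bops"
  by (simp add: poisson_transform_def bops_poisson_kernel[OF X] A)

subsection \<open>Power series with square-summable coefficients\<close>

text \<open>Stronger than \<open>cinner_Cauchy_Schwarz\<close>, since the absolute values stand
  inside the sum; the interchange of summations needs this form.\<close>

lemma ell2_Cauchy_Schwarz_abs:
  fixes v w :: "('i, 'h::complex_inner) ell2"
  shows "(\<lambda>i. cmod (cinner (Rep_ell2 v i) (Rep_ell2 w i))) summable_on UNIV"
    and "(\<Sum>\<^sub>\<infinity>i. cmod (cinner (Rep_ell2 v i) (Rep_ell2 w i))) \<le> norm v * norm w"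
proof -
  have bound: "(\<Sum>i\<in>F. cmod (cinner (Rep_ell2 v i) (Rep_ell2 w i))) \<le> norm v * norm w" if "finite F" for F
  proof -
    have L2: "L2_set (\<lambda>i. norm (Rep_ell2 u i)) F \<le> norm u" for u :: "('i, 'h) ell2"
      unfolding L2_set_def using sum_Rep_ell2_le[OF that, of u] by (intro real_le_lsqrt) (auto simp: sum_nonneg)
    have "(\<Sum>i\<in>F. cmod (cinner (Rep_ell2 v i) (Rep_ell2 w i))) \<le>
        (\<Sum>i\<in>F. \<bar>norm (Rep_ell2 v i)\<bar> * \<bar>norm (Rep_ell2 w i)\<bar>)"
      by (intro sum_mono) (simp add: cinner_Cauchy_Schwarz)
    also have "\<dots> \<le> L2_set (\<lambda>i. norm (Rep_ell2 v i)) F * L2_set (\<lambda>i. norm (Rep_ell2 w i)) F"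
      by (rule L2_set_mult_ineq)
    also have "\<dots> \<le> norm v * norm w" by (intro mult_mono L2) auto
    finally show ?thesis .
  qed
  show sum: "(\<lambda>i. cmod (cinner (Rep_ell2 v i) (Rep_ell2 w i))) summable_on UNIV"
    by (rule nonneg_bdd_above_summable_on) (auto intro!: bdd_aboveI2 bound)
  show "(\<Sum>\<^sub>\<infinity>i. cmod (cinner (Rep_ell2 v i) (Rep_ell2 w i))) \<le> norm v * norm w"
    by (rule infsum_le_finite_sums[OF sum]) (rule bound)
qed

text \<open>Cauchy-Schwarz over all words of one length, instead of a bound for each word, keeps
  their number out of the estimate.\<close>

lemma sum_words_adj_le:
  fixes X :: "'n::finite \<Rightarrow> 'h::chilbert_space \<Rightarrow>\<^sub>L 'h"
  assumes X: "X \<in> row_ball"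
  shows "(\<Sum>\<alpha> | length \<alpha> = k. cmod (Rep_ell2 g \<alpha>) * norm (blinfun_apply (adj (word_op X \<alpha>)) y))
    \<le> norm g * sqrt (norm (\<Sum>i\<in>UNIV. X i o\<^sub>L adj (X i))) ^ k * norm y"
proof -
  let ?q = "norm (\<Sum>i\<in>UNIV. X i o\<^sub>L adj (X i))" and ?A = "{\<alpha> :: 'n list. length \<alpha> = k}"
  have "(\<Sum>\<alpha>\<in>?A. cmod (Rep_ell2 g \<alpha>) * norm (blinfun_apply (adj (word_op X \<alpha>)) y)) \<le>
      L2_set (\<lambda>\<alpha>. cmod (Rep_ell2 g \<alpha>)) ?A * L2_set (\<lambda>\<alpha>. norm (blinfun_apply (adj (word_op X \<alpha>)) y)) ?A"
    using L2_set_mult_ineq[of "\<lambda>\<alpha>. cmod (Rep_ell2 g \<alpha>)" "\<lambda>\<alpha>. norm (blinfun_apply (adj (word_op X \<alpha>)) y)" ?A]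
    by simp
  also have "\<dots> \<le> norm g * (sqrt ?q ^ k * norm y)"
  proof (intro mult_mono)
    show "L2_set (\<lambda>\<alpha>. cmod (Rep_ell2 g \<alpha>)) ?A \<le> norm g"
      unfolding L2_set_def using sum_Rep_ell2_le[of ?A g] by (intro real_le_lsqrt) (auto simp: sum_nonneg)
    have "(sqrt ?q ^ k * norm y)\<^sup>2 = ?q ^ k * (norm y)\<^sup>2"
      by (simp add: power_mult_distrib flip: power_mult) (simp add: power_mult mult.commute[of k])
    then show "L2_set (\<lambda>\<alpha>. norm (blinfun_apply (adj (word_op X \<alpha>)) y)) ?A \<le> sqrt ?q ^ k * norm y"
      unfolding L2_set_def using word_square_sum_le[OF X, of y k]
      by (intro real_le_lsqrt) (auto simp: word_square_sum_def sum_nonneg)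
  qed (auto simp: L2_set_nonneg)
  finally show ?thesis by (simp add: mult.assoc)
qed

lemma summable_words_adj:
  fixes X :: "'n::finite \<Rightarrow> 'h::chilbert_space \<Rightarrow>\<^sub>L 'h"
  assumes X: "X \<in> row_ball"
  shows "(\<lambda>\<alpha>. cmod (Rep_ell2 g \<alpha>) * norm (blinfun_apply (adj (word_op X \<alpha>)) y)) summable_on UNIV"
proof (rule summable_on_words)
  let ?s = "sqrt (norm (\<Sum>i\<in>UNIV. X i o\<^sub>L adj (X i)))"
  have "summable (\<lambda>k. norm g * ?s ^ k * norm y)"
    using row_ballD(2)[OF X] by (intro summable_mult summable_mult2 summable_geometric) simp
  then show "summable (\<lambda>k. \<Sum>\<alpha> | length \<alpha> = k. cmod (Rep_ell2 g \<alpha>) * norm (blinfun_apply (adj (word_op X \<alpha>)) y))"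
    by (rule summable_comparison_test_ev[rotated])
       (intro always_eventually allI order.trans[OF _ sum_words_adj_le[OF X]], simp add: sum_nonneg)
qed simp

text \<open>Defined for every Fock space vector, so linear combinations such as \<open>g + h\<close>
  require no membership in \<open>F_infinity\<close>.\<close>

definition word_series :: "'n::finite fock \<Rightarrow> ('n \<Rightarrow> 'h::complex_inner \<Rightarrow>\<^sub>L 'h) \<Rightarrow> 'h \<Rightarrow>\<^sub>L 'h" where
  "word_series g X = (\<Sum>k. \<Sum>\<alpha> | length \<alpha> = k. Rep_ell2 g \<alpha> *\<^sub>C word_op X \<alpha>)"

text \<open>By duality: pairing the image \<open>w\<close> with itself moves the words to the other
  side as adjoints acting on \<open>w\<close>, where \<open>sum_words_adj_le\<close>
  applies.\<close>

lemma norm_word_level_le: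
  fixes X :: "'n::finite \<Rightarrow> 'h::chilbert_space \<Rightarrow>\<^sub>L 'h"
  assumes X: "X \<in> row_ball"
  shows "norm (\<Sum>\<alpha> | length \<alpha> = k. Rep_ell2 g \<alpha> *\<^sub>C word_op X \<alpha>)
    \<le> norm g * sqrt (norm (\<Sum>i\<in>UNIV. X i o\<^sub>L adj (X i))) ^ k" (is "norm ?T \<le> ?b")
proof (rule norm_blinfun_bound)
  fix x
  define w where "w = blinfun_apply ?T x"
  have "(norm w)\<^sup>2 = cmod (cinner (blinfun_apply ?T x) w)"
    by (simp add: w_def[symmetric] cinner_self del: of_real_power)
  also have "cinner (blinfun_apply ?T x) w =
      (\<Sum>\<alpha> | length \<alpha> = k. Rep_ell2 g \<alpha> * cinner x (blinfun_apply (adj (word_op X \<alpha>)) w))"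
    by (simp add: blinfun_apply_sum cinner.sum_left cinner_scaleC_left
        cinner_adj_right bops_word_op row_ballD(1)[OF X])
  also have "cmod \<dots> \<le> (\<Sum>\<alpha> | length \<alpha> = k. norm x *
      (cmod (Rep_ell2 g \<alpha>) * norm (blinfun_apply (adj (word_op X \<alpha>)) w)))"
    by (intro sum_norm_le)
       (simp add: norm_mult mult.left_commute[of "norm x"] cinner_Cauchy_Schwarz mult_left_mono)
  also have "\<dots> \<le> norm x * (?b * norm w)"
    unfolding sum_distrib_left[symmetric] by (intro mult_left_mono sum_words_adj_le[OF X]) simp
  finally have "norm w * norm w \<le> ?b * norm x * norm w"
    by (simp add: power2_eq_square mult_ac)
  then show "norm (blinfun_apply ?T x) \<le> ?b * norm x"
    unfolding w_def[symmetric] by (cases "w = 0") auto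
qed simp

lemma word_series_sums:
  fixes X :: "'n::finite \<Rightarrow> 'h::chilbert_space \<Rightarrow>\<^sub>L 'h"
  assumes X: "X \<in> row_ball"
  shows "(\<lambda>k. \<Sum>\<alpha> | length \<alpha> = k. Rep_ell2 g \<alpha> *\<^sub>C word_op X \<alpha>) sums word_series g X"
  unfolding word_series_def
proof (rule summable_sums, rule summable_comparison_test_ev)
  show "\<forall>\<^sub>F k in sequentially. norm (\<Sum>\<alpha> | length \<alpha> = k. Rep_ell2 g \<alpha> *\<^sub>C word_op X \<alpha>)
      \<le> norm g * sqrt (norm (\<Sum>i\<in>UNIV. X i o\<^sub>L adj (X i))) ^ k"
    by (intro always_eventually allI norm_word_level_le[OF X])
  show "summable (\<lambda>k. norm g * sqrt (norm (\<Sum>i\<in>UNIV. X i o\<^sub>L adj (X i))) ^ k)"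
    using row_ballD(2)[OF X] by (intro summable_mult summable_geometric) simp
qed

lemma word_series_add:
  fixes X :: "'n::finite \<Rightarrow> 'h::chilbert_space \<Rightarrow>\<^sub>L 'h"
  assumes X: "X \<in> row_ball"
  shows "word_series (g + h) X = word_series g X + word_series h X"
  using sums_add[OF word_series_sums[OF X, of g] word_series_sums[OF X, of h]]
    word_series_sums[OF X, of "g + h"]
  by (simp add: plus_ell2.rep_eq scaleC_add_left sum.distrib sums_iff)

lemma word_series_scaleC:
  fixes X :: "'n::finite \<Rightarrow> 'h::chilbert_space \<Rightarrow>\<^sub>L 'h"
  assumes X: "X \<in> row_ball"
  shows "word_series (c *\<^sub>C g) X = c *\<^sub>C word_series g X"
proof (rule blinfun_eqI)
  fix x
  have lin: "bounded_linear (\<lambda>T::'h \<Rightarrow>\<^sub>L 'h. blinfun_apply T x)" by (rule blinfun.bounded_linear_left)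
  have "(\<lambda>k. c *\<^sub>C blinfun_apply (\<Sum>\<alpha> | length \<alpha> = k. Rep_ell2 g \<alpha> *\<^sub>C word_op X \<alpha>) x) sums
      (c *\<^sub>C blinfun_apply (word_series g X) x)"
    by (intro bounded_linear.sums[OF bounded_linear_scaleC] bounded_linear.sums[OF lin] word_series_sums[OF X])
  then have "(\<lambda>k. blinfun_apply (\<Sum>\<alpha> | length \<alpha> = k. Rep_ell2 (c *\<^sub>C g) \<alpha> *\<^sub>C word_op X \<alpha>) x) sums
      blinfun_apply (c *\<^sub>C word_series g X) x"
    by (simp only: blinfun_apply_sum scaleC_ell2.rep_eq scaleC_complex_def scaleC_blinfun_apply
        scaleC.sum_right scaleC_scaleC)
  moreover have "(\<lambda>k. blinfun_apply (\<Sum>\<alpha> | length \<alpha> = k. Rep_ell2 (c *\<^sub>C g) \<alpha> *\<^sub>C word_op X \<alpha>) x) sums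
      blinfun_apply (word_series (c *\<^sub>C g) X) x"
    by (intro bounded_linear.sums[OF lin] word_series_sums[OF X])
  ultimately show "blinfun_apply (word_series (c *\<^sub>C g) X) x = blinfun_apply (c *\<^sub>C word_series g X) x"
    by (rule sums_unique2[symmetric])
qed

lemma free_holomorphic_word_series:
  "free_holomorphic (word_series g :: ('n::finite \<Rightarrow> 'h::chilbert_space \<Rightarrow>\<^sub>L 'h) \<Rightarrow> 'h \<Rightarrow>\<^sub>L 'h)"
  unfolding free_holomorphic_def
proof (intro exI conjI ballI)
  \<comment> \<open>At least 1, because the limit of \<open>root n C\<close> is taken for a positive
    constant. The degree \<open>k = 0\<close> is separate: there both sides are
    \<open>root 0\<close>, which is 0 by convention.\<close>
  define C where "C = max 1 ((norm g)\<^sup>2)"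
  have "root (2 * k) (\<Sum>\<alpha> | length \<alpha> = k. (cmod (Rep_ell2 g \<alpha>))\<^sup>2) \<le> root (2 * k) C" for k
  proof (cases "k = 0")
    case False
    have "(\<Sum>\<alpha> | length \<alpha> = k. (cmod (Rep_ell2 g \<alpha>))\<^sup>2) \<le> C"
      using sum_Rep_ell2_le[of "{\<alpha>. length \<alpha> = k}" g] by (simp add: C_def)
    then show ?thesis using False by (intro real_root_le_mono) auto
  qed simp
  then have "limsup (\<lambda>k. ereal (root (2 * k) (\<Sum>\<alpha> | length \<alpha> = k. (cmod (Rep_ell2 g \<alpha>))\<^sup>2))) \<le>
      limsup (\<lambda>k. ereal (root (2 * k) C))"
    by (intro Limsup_mono always_eventually) simp
  also have "(\<lambda>n. root n C) \<longlonglongrightarrow> 1" by (rule LIMSEQ_root_const) (simp add: C_def)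
  then have "(\<lambda>k. root (2 * k) C) \<longlonglongrightarrow> 1"
    using LIMSEQ_subseq_LIMSEQ[of "\<lambda>n. root n C" 1 "\<lambda>k. 2 * k"] by (simp add: o_def strict_mono_def)
  then have "limsup (\<lambda>k. ereal (root (2 * k) C)) = 1"
    by (intro lim_imp_Limsup) (simp_all add: one_ereal_def)
  finally show "limsup (\<lambda>k. ereal (root (2 * k) (\<Sum>\<alpha> | length \<alpha> = k. (cmod (Rep_ell2 g \<alpha>))\<^sup>2))) \<le> 1" .
qed (rule word_series_sums)

text \<open>
  The Poisson transform of \<open>L\<^sub>g\<close> is computed weakly. In the double series indexed by the
  factorisations \<open>\<alpha>\<beta>\<close> of words, summing over \<open>\<alpha>\<close> first gives the tensor product operator and
  summing over \<open>\<beta>\<close> first gives the power series, because \<open>(K\<^sub>X y)(\<alpha>\<beta>) = (K\<^sub>X X\<^sub>\<alpha>\<^sup>* y)(\<beta>)\<close> and \<open>K\<^sub>X\<close>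
  is isometric.
\<close>

lemma has_sum_poisson_left_mult:
  fixes X :: "'n::finite \<Rightarrow> 'h::chilbert_space \<Rightarrow>\<^sub>L 'h"
  assumes X: "X \<in> row_ball" and g: "g \<in> F_infinity"
  shows "((\<lambda>\<alpha>. Rep_ell2 g \<alpha> * cinner (blinfun_apply (word_op X \<alpha>) x) y) has_sum
    cinner (blinfun_apply (poisson_transform (left_mult g) X) x) y) UNIV"
proof -
  let ?K = "blinfun_apply (poisson_kernel X)"
  define \<phi> where "\<phi> p = Rep_ell2 g (fst p) * cinner (Rep_ell2 (?K x) (snd p)) (Rep_ell2 (?K y) (fst p @ snd p))"
    for p
  have \<phi>_row: "\<phi> (\<alpha>, \<beta>) = Rep_ell2 g \<alpha> *
      cinner (Rep_ell2 (?K x) \<beta>) (Rep_ell2 (?K (blinfun_apply (adj (word_op X \<alpha>)) y)) \<beta>)" for \<alpha> \<beta>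
    by (simp add: \<phi>_def Rep_poisson_kernel_append[OF X])
  have norm_row: "(\<Sum>\<^sub>\<infinity>\<beta>. cmod (\<phi> (\<alpha>, \<beta>))) \<le>
      norm x * (cmod (Rep_ell2 g \<alpha>) * norm (blinfun_apply (adj (word_op X \<alpha>)) y))" for \<alpha>
    using mult_left_mono[OF ell2_Cauchy_Schwarz_abs(2)[of "?K x" "?K (blinfun_apply (adj (word_op X \<alpha>)) y)"],
        of "cmod (Rep_ell2 g \<alpha>)"]
    by (simp add: \<phi>_row norm_mult infsum_cmult_right' norm_poisson_kernel[OF X] mult_ac)
  \<comment> \<open>Each row is bounded by Cauchy-Schwarz and the isometry of the kernel; the row
    bounds are summable by the geometric decay of the levels.\<close>
  have "(\<lambda>p. cmod (\<phi> p)) summable_on UNIV \<times> UNIV"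
    unfolding Infinite_Sum.abs_summable_on_Sigma_iff
  proof (intro conjI ballI)
    show "(\<lambda>\<beta>. cmod (\<phi> (\<alpha>, \<beta>))) summable_on UNIV" for \<alpha>
      unfolding \<phi>_row norm_mult by (intro summable_on_cmult_right ell2_Cauchy_Schwarz_abs(1))
    have "(\<lambda>\<alpha>. norm x * (cmod (Rep_ell2 g \<alpha>) * norm (blinfun_apply (adj (word_op X \<alpha>)) y))) summable_on UNIV"
      by (intro summable_on_cmult_right summable_words_adj[OF X])
    then show "(\<lambda>\<alpha>. norm (\<Sum>\<^sub>\<infinity>\<beta>. cmod (\<phi> (\<alpha>, \<beta>)))) summable_on UNIV"
      by (rule summable_on_comparison_test) (auto simp: norm_row infsum_nonneg)
  qed
  then have "\<phi> summable_on UNIV \<times> UNIV" by (rule abs_summable_summable)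
  then obtain s where s: "(\<phi> has_sum s) (UNIV \<times> UNIV)" by (auto simp: summable_on_def)
  have rows: "((\<lambda>\<alpha>. Rep_ell2 g \<alpha> * cinner (blinfun_apply (word_op X \<alpha>) x) y) has_sum s) UNIV"
  proof (rule has_sum_SigmaD[OF s])
    fix \<alpha>
    let ?z = "blinfun_apply (adj (word_op X \<alpha>)) y"
    have "((\<lambda>\<beta>. cinner (Rep_ell2 (?K x) \<beta>) (Rep_ell2 (?K ?z) \<beta>)) has_sum cinner (?K x) (?K ?z)) UNIV"
      unfolding cinner_ell2.rep_eq
      by (rule has_sum_infsum) (rule ell2_cinner_summable[OF summable_Rep_ell2 summable_Rep_ell2])
    then have "((\<lambda>\<beta>. \<phi> (\<alpha>, \<beta>)) has_sum Rep_ell2 g \<alpha> * cinner (?K x) (?K ?z)) UNIV"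
      unfolding \<phi>_row by (rule has_sum_cmult_right)
    then show "((\<lambda>\<beta>. \<phi> (\<alpha>, \<beta>)) has_sum Rep_ell2 g \<alpha> * cinner (blinfun_apply (word_op X \<alpha>) x) y) UNIV"
      by (simp add: cinner_poisson_kernel[OF X] cinner_adj_right bops_word_op row_ballD(1)[OF X])
  qed
  \<comment> \<open>With the indices exchanged, the inner sums are those of
    \<open>has_sum_left_mult_basis\<close>.\<close>
  have "((\<lambda>(\<beta>, \<alpha>). \<phi> (\<alpha>, \<beta>)) has_sum s) (UNIV \<times> UNIV)"
    using s has_sum_swap by blast
  then have "((\<lambda>\<beta>. cinner (blinfun_apply (left_mult g) (fock_basis \<beta>) \<otimes>\<^sub>2 Rep_ell2 (?K x) \<beta>) (?K y)) has_sum s) UNIV"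
    by (rule has_sum_SigmaD) (simp add: \<phi>_def has_sum_left_mult_basis[OF g])
  moreover have "((\<lambda>\<beta>. cinner (blinfun_apply (tensor_id_op (left_mult g))
      (fock_basis \<beta> \<otimes>\<^sub>2 Rep_ell2 (?K x) \<beta>)) (?K y)) has_sum
      cinner (blinfun_apply (tensor_id_op (left_mult g)) (?K x)) (?K y)) UNIV"
    by (intro has_sum_bounded_linear[OF cinner.bounded_linear_left]
        has_sum_bounded_linear[OF blinfun.bounded_linear_right] has_sum_fock)
  ultimately have "s = cinner (blinfun_apply (tensor_id_op (left_mult g)) (?K x)) (?K y)"
    using has_sum_unique by (simp add: tensor_id_op_apply[OF bops_left_mult[OF g]]) blast
  then show ?thesis using rows by (simp add: cinner_poisson_transform[OF X])
qed

lemma poisson_left_mult: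
  fixes X :: "'n::finite \<Rightarrow> 'h::chilbert_space \<Rightarrow>\<^sub>L 'h"
  assumes X: "X \<in> row_ball" and g: "g \<in> F_infinity"
  shows "poisson_transform (left_mult g) X = word_series g X"
proof (rule blinfun_eqI, rule cinner_extI)
  fix x y
  have "(\<lambda>k. cinner (blinfun_apply (\<Sum>\<alpha> | length \<alpha> = k. Rep_ell2 g \<alpha> *\<^sub>C word_op X \<alpha>) x) y) sums
      cinner (blinfun_apply (word_series g X) x) y"
    by (intro bounded_linear.sums[OF cinner.bounded_linear_left]
        bounded_linear.sums[OF blinfun.bounded_linear_left] word_series_sums[OF X])
  then have "(\<lambda>k. \<Sum>\<alpha> | length \<alpha> = k. Rep_ell2 g \<alpha> * cinner (blinfun_apply (word_op X \<alpha>) x) y) sums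
      cinner (blinfun_apply (word_series g X) x) y"
    by (simp add: blinfun_apply_sum cinner.sum_left cinner_scaleC_left)
  with has_sum_words_imp_sums[OF has_sum_poisson_left_mult[OF X g]]
  show "cinner (blinfun_apply (poisson_transform (left_mult g) X) x) y =
      cinner (blinfun_apply (word_series g X) x) y"
    by (rule sums_unique2)
qed

section \<open>Poisson transforms of harmonic symbols\<close>

lemma poisson_transform_add:
  fixes X :: "'n::finite \<Rightarrow> 'h::chilbert_space \<Rightarrow>\<^sub>L 'h"
  assumes "A \<in> bops" "B \<in> bops"
  shows "poisson_transform (A + B) X = poisson_transform A X + poisson_transform B X"
  by (simp add: poisson_transform_def tensor_id_op_add assms blinfun_compose.add_left blinfun_compose.add_right)

lemma poisson_transform_adj:
  fixes X :: "'n::finite \<Rightarrow> 'h::chilbert_space \<Rightarrow>\<^sub>L 'h"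
  assumes X: "X \<in> row_ball" and A: "A \<in> bops"
  shows "poisson_transform (adj A) X = adj (poisson_transform A X)"
proof (rule adjI[symmetric])
  fix x y
  show "cinner (blinfun_apply (poisson_transform A X) x) y = cinner x (blinfun_apply (poisson_transform (adj A) X) y)"
    using cinner_commute[of x "blinfun_apply (poisson_transform (adj A) X) y"]
    by (simp add: cinner_poisson_transform[OF X] tensor_id_op_adj[OF A] cinner_adj_left A
        flip: cinner_commute)
qed

lemma poisson_transform_harmonic:
  fixes X :: "'n::finite \<Rightarrow> 'h::chilbert_space \<Rightarrow>\<^sub>L 'h"
  assumes X: "X \<in> row_ball" and "h \<in> F_infinity" "g \<in> F_infinity"
  shows "poisson_transform (adj (left_mult h) + left_mult g) X = adj (word_series h X) + word_series g X"
  using assms by (simp add: poisson_transform_add poisson_transform_adj poisson_left_mult)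

lemma free_pluriharmonic_poisson_transform:
  assumes h: "h \<in> F_infinity" and g: "g \<in> F_infinity"
  shows "free_pluriharmonic (poisson_transform (adj (left_mult h) + left_mult g) ::
    ('n::finite \<Rightarrow> 'h::chilbert_space \<Rightarrow>\<^sub>L 'h) \<Rightarrow> 'h \<Rightarrow>\<^sub>L 'h)"
  unfolding free_pluriharmonic_def
proof (intro exI conjI ballI)
  define re where "re F X = (1 / 2) *\<^sub>R (F X + adj (F X))"
    for F :: "('n \<Rightarrow> 'h \<Rightarrow>\<^sub>L 'h) \<Rightarrow> 'h \<Rightarrow>\<^sub>L 'h" and X
  show "sa_free_pluriharmonic (re (word_series (g + h)))"
    "sa_free_pluriharmonic (re (word_series ((- \<i>) *\<^sub>C (g + (- 1) *\<^sub>C h))))"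
    unfolding sa_free_pluriharmonic_def re_def using free_holomorphic_word_series by blast+
  fix X :: "'n \<Rightarrow> 'h \<Rightarrow>\<^sub>L 'h" assume X: "X \<in> row_ball"
  define G H where "G = word_series g X" and "H = word_series h X"
  \<comment> \<open>Complex linearity of the two series is inherited from the Poisson transforms
    they equal.\<close>
  have GH: "G \<in> bops" "H \<in> bops"
    using bops_poisson_transform[OF X] poisson_left_mult[OF X] g h
    unfolding G_def H_def by (metis bops_left_mult)+
  have "re (word_series (g + h)) X = (1 / 2) *\<^sub>R (G + H + (adj G + adj H))"
    by (simp add: re_def word_series_add[OF X] G_def[symmetric] H_def[symmetric] adj_add GH)
  moreover have "word_series ((- \<i>) *\<^sub>C (g + (- 1) *\<^sub>C h)) X = (- \<i>) *\<^sub>C (G - H)"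
    by (simp only: word_series_add[OF X] word_series_scaleC[OF X] G_def[symmetric] H_def[symmetric])
       (simp add: scaleC_one)
  then have "re (word_series ((- \<i>) *\<^sub>C (g + (- 1) *\<^sub>C h))) X = (1 / 2) *\<^sub>R ((- \<i>) *\<^sub>C (G - H) + \<i> *\<^sub>C (adj G - adj H))"
    unfolding re_def by (simp only: adj_scaleC[OF bops_diff[OF GH]] adj_diff[OF GH]) simp
  moreover have "\<i> *\<^sub>C (1 / 2) *\<^sub>R ((- \<i>) *\<^sub>C (G - H) + \<i> *\<^sub>C (adj G - adj H)) =
      (1 / 2) *\<^sub>R ((G - H) - (adj G - adj H))"
    by (rule blinfun_eqI)
       (simp add: blinfun.scaleR_left scaleC.scaleR_right scaleC_add_right scaleC_scaleC blinfun.add_left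
         blinfun.diff_left scaleC_one scaleC.minus_left scaleC.diff_right)
  moreover have "(1 / 2) *\<^sub>R (G + H + (adj G + adj H)) + (1 / 2) *\<^sub>R ((G - H) - (adj G - adj H)) = adj H + G"
  proof -
    have "G + H + (adj G + adj H) + ((G - H) - (adj G - adj H)) = (adj H + G) + (adj H + G)"
      by simp
    then show ?thesis by (metis scaleR_add_right scaleR_half_double)
  qed
  ultimately show "poisson_transform (adj (left_mult h) + left_mult g) X =
      re (word_series (g + h)) X + \<i> *\<^sub>C re (word_series ((- \<i>) *\<^sub>C (g + (- 1) *\<^sub>C h))) X"
    by (simp only: poisson_transform_harmonic[OF X h g] G_def H_def)
qed

subsection \<open>Truncated creation operators\<close>

lemma orthonormal_on_subset: "orthonormal_on A e \<Longrightarrow> B \<subseteq> A \<Longrightarrow> orthonormal_on B e"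
  unfolding orthonormal_on_def by blast

text \<open>No finite family spans the space, so some vector has a nonzero residual, which after
  normalization is the next element.\<close>

lemma orthonormal_family_exists:
  assumes inf: "infinite_dimensional TYPE('h::complex_inner)" and "finite A"
  shows "\<exists>e :: 'i \<Rightarrow> 'h. orthonormal_on A e"
  using assms(2)
proof (induction A)
  case empty
  show ?case by (auto simp: orthonormal_on_def)
next
  case (insert a A)
  then obtain e :: "'i \<Rightarrow> 'h" where e: "orthonormal_on A e" by blast
  have "complex_vector.span (e ` A) \<noteq> UNIV"
    using inf insert(1) unfolding infinite_dimensional_def by blast
  then obtain v where v: "v \<notin> complex_vector.span (e ` A)" by blast
  define w where "w = v - (\<Sum>k\<in>A. cinner v (e k) *\<^sub>C e k)"
  have "(\<Sum>k\<in>A. cinner v (e k) *\<^sub>C e k) \<in> complex_vector.span (e ` A)"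
    by (intro complex_vector.span_sum complex_vector.span_scale complex_vector.span_base) auto
  then have "w \<noteq> 0" using v by (auto simp: w_def)
  have "orthonormal_on (insert a A) (e(a := complex_of_real (1 / norm w) *\<^sub>C w))"
    by (rule orthonormal_on_insert[OF e insert(2) \<open>w \<noteq> 0\<close>])
       (simp only: w_def orthonormal_residual[OF e insert(1)])
  then show ?case by blast
qed

text \<open>The sum \<open>p\<close> satisfies \<open>cinner p p = cinner h p\<close>, so
  Cauchy-Schwarz bounds it. It estimates the projection appearing in
  \<open>truncated_shift_row_ball\<close>.\<close>

lemma Bessel:
  assumes "orthonormal_on A e" "finite A"
  shows "norm (\<Sum>k\<in>A. cinner h (e k) *\<^sub>C e k) \<le> norm h"
proof -
  define p where "p = (\<Sum>k\<in>A. cinner h (e k) *\<^sub>C e k)"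
  have "cinner (h - p) p = (\<Sum>k\<in>A. cnj (cinner h (e k)) * cinner (h - p) (e k))"
    by (subst (2) p_def) (simp only: cinner.sum_right cinner_scaleC_right)
  also have "\<dots> = 0"
    using orthonormal_residual[OF assms] by (intro sum.neutral) (simp add: p_def)
  finally have "cinner p p = cinner h p" by (simp add: cinner.diff_left)
  then have "(norm p)\<^sup>2 = cmod (cinner h p)"
    by (metis cinner_self norm_of_real abs_of_nonneg zero_le_power2)
  also have "\<dots> \<le> norm h * norm p" by (rule cinner_Cauchy_Schwarz)
  finally have "norm p * norm p \<le> norm h * norm p" by (simp add: power2_eq_square)
  then have "norm p \<le> norm h" by (cases "p = 0") auto
  then show ?thesis by (simp only: p_def)
qed

definition rank_one :: "'h::complex_inner \<Rightarrow> 'h \<Rightarrow> 'h \<Rightarrow>\<^sub>L 'h" where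
  "rank_one a b = Blinfun (\<lambda>h. cinner h a *\<^sub>C b)"

lemma rank_one_apply: "blinfun_apply (rank_one a b) h = cinner h a *\<^sub>C b"
  unfolding rank_one_def
  by (subst bounded_linear_Blinfun_apply)
     (intro bounded_linear_compose[OF scaleC.bounded_linear_left] cinner.bounded_linear_left, simp)

lemma bops_rank_one [simp]: "rank_one a b \<in> bops"
  by (simp add: bops_def rank_one_apply cinner_scaleC_left scaleC_scaleC)

text \<open>
  \<open>r\<close> times the compression of the left creation operators to the span of the words of length at
  most \<open>m\<close>, transported along the orthonormal family \<open>e\<close>.
\<close>

definition truncated_shift :: "real \<Rightarrow> nat \<Rightarrow> ('n::finite list \<Rightarrow> 'h::complex_inner) \<Rightarrow> 'n \<Rightarrow> 'h \<Rightarrow>\<^sub>L 'h" where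
  "truncated_shift r m e i = (\<Sum>\<alpha> | length \<alpha> < m. r *\<^sub>R rank_one (e \<alpha>) (e (i # \<alpha>)))"

lemma finite_words_less [simp]: "finite {\<alpha> :: 'n::finite list. length \<alpha> < m}"
  by (rule finite_subset[OF _ finite_words_le[of m]]) auto

lemma truncated_shift_apply:
  "blinfun_apply (truncated_shift r m e i) h = (\<Sum>\<alpha> | length \<alpha> < m. (of_real r * cinner h (e \<alpha>)) *\<^sub>C e (i # \<alpha>))"
  by (simp only: truncated_shift_def blinfun_apply_sum blinfun.scaleR_left rank_one_apply
      scaleC_of_real[symmetric] scaleC_scaleC scaleC_blinfun_apply)

lemma truncated_shift_basis:
  assumes "orthonormal_on {\<alpha>. length \<alpha> \<le> m} e" "length \<beta> \<le> m"
  shows "blinfun_apply (truncated_shift r m e i) (e \<beta>) =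
    (if length \<beta> < m then of_real r *\<^sub>C e (i # \<beta>) else 0)"
proof -
  have "blinfun_apply (truncated_shift r m e i) (e \<beta>) =
      (\<Sum>\<alpha> | length \<alpha> < m. if \<alpha> = \<beta> then of_real r *\<^sub>C e (i # \<beta>) else 0)"
    unfolding truncated_shift_apply using assms
    by (intro sum.cong) (auto simp: orthonormal_on_def scaleC.zero_left)
  then show ?thesis by simp
qed

lemma adj_truncated_shift:
  "adj (truncated_shift r m e i) = (\<Sum>\<alpha> | length \<alpha> < m. r *\<^sub>R rank_one (e (i # \<alpha>)) (e \<alpha>))"
proof (rule adjI)
  fix x y
  have "cnj (cinner y (e (i # \<alpha>))) = cinner (e (i # \<alpha>)) y" for \<alpha>
    by (rule cinner_commute[symmetric])
  then show "cinner (blinfun_apply (truncated_shift r m e i) x) y =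
      cinner x (blinfun_apply (\<Sum>\<alpha> | length \<alpha> < m. r *\<^sub>R rank_one (e (i # \<alpha>)) (e \<alpha>)) y)"
    by (simp add: truncated_shift_apply blinfun_apply_sum blinfun.scaleR_left rank_one_apply
        cinner.sum_left cinner.sum_right cinner_scaleC_left cinner_scaleC_right cinner_scaleR_right
        scaleR_conv_of_real mult_ac)
qed

text \<open>\<open>X i o\<^sub>L adj (X i)\<close> is \<open>r\<^sup>2\<close> times the projection
  onto the words of length at most \<open>m\<close> beginning with \<open>i\<close>. Different
  letters give disjoint sets of words, so the sum is \<open>r\<^sup>2\<close> times a single
  projection.\<close>

lemma truncated_shift_row_ball:
  fixes e :: "'n::finite list \<Rightarrow> 'h::chilbert_space"
  assumes e: "orthonormal_on {\<alpha>. length \<alpha> \<le> m} e" and r: "0 < r" "r < 1"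
  shows "truncated_shift r m e \<in> row_ball"
proof -
  let ?X = "truncated_shift r m e"
  let ?D = "(\<lambda>(i, \<alpha>). i # \<alpha>) ` (UNIV \<times> {\<alpha> :: 'n list. length \<alpha> < m})"
  have "norm (\<Sum>i\<in>UNIV. ?X i o\<^sub>L adj (?X i)) \<le> r\<^sup>2"
  proof (rule norm_blinfun_bound)
    fix h
    have "blinfun_apply (?X i) (blinfun_apply (adj (?X i)) h) =
        (\<Sum>\<alpha> | length \<alpha> < m. (r\<^sup>2) *\<^sub>R cinner h (e (i # \<alpha>)) *\<^sub>C e (i # \<alpha>))" for i
      unfolding adj_truncated_shift blinfun_apply_sum blinfun.sum_right
    proof (rule sum.cong)
      fix \<alpha> :: "'n list" assume \<alpha>: "\<alpha> \<in> {\<alpha>. length \<alpha> < m}"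
      have "?X i \<in> bops" by (simp add: truncated_shift_def)
      then show "blinfun_apply (?X i) (blinfun_apply (r *\<^sub>R rank_one (e (i # \<alpha>)) (e \<alpha>)) h) =
          r\<^sup>2 *\<^sub>R cinner h (e (i # \<alpha>)) *\<^sub>C e (i # \<alpha>)"
        using \<alpha> by (simp add: blinfun.scaleR_left blinfun.scaleR_right rank_one_apply bopsD
            truncated_shift_basis[OF e] scaleC_of_real scaleC.scaleR_right power2_eq_square)
    qed simp
    then have "blinfun_apply (\<Sum>i\<in>UNIV. ?X i o\<^sub>L adj (?X i)) h =
        r\<^sup>2 *\<^sub>R (\<Sum>i\<in>UNIV. \<Sum>\<alpha> | length \<alpha> < m. cinner h (e (i # \<alpha>)) *\<^sub>C e (i # \<alpha>))"
      by (simp add: blinfun_apply_sum scaleR_sum_right)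
    also have "\<dots> = r\<^sup>2 *\<^sub>R (\<Sum>\<delta>\<in>?D. cinner h (e \<delta>) *\<^sub>C e \<delta>)"
      unfolding sum.cartesian_product
      by (subst sum.reindex) (auto simp: inj_on_def case_prod_unfold)
    finally have "norm (blinfun_apply (\<Sum>i\<in>UNIV. ?X i o\<^sub>L adj (?X i)) h) =
        r\<^sup>2 * norm (\<Sum>\<delta>\<in>?D. cinner h (e \<delta>) *\<^sub>C e \<delta>)" by simp
    also have "\<dots> \<le> r\<^sup>2 * norm h"
      by (intro mult_left_mono Bessel orthonormal_on_subset[OF e]) auto
    finally show "norm (blinfun_apply (\<Sum>i\<in>UNIV. ?X i o\<^sub>L adj (?X i)) h) \<le> r\<^sup>2 * norm h" .
  qed simp
  also have "r\<^sup>2 < 1" using r by (simp add: power_less_one_iff)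
  finally show ?thesis by (simp add: row_ball_def truncated_shift_def)
qed

lemma word_op_truncated_shift:
  assumes e: "orthonormal_on {\<alpha>. length \<alpha> \<le> m} e" and "length \<beta> \<le> m"
  shows "blinfun_apply (word_op (truncated_shift r m e) \<alpha>) (e \<beta>) =
    (if length (\<alpha> @ \<beta>) \<le> m then (of_real r ^ length \<alpha>) *\<^sub>C e (\<alpha> @ \<beta>) else 0)"
proof (induction \<alpha>)
  case (Cons i \<alpha>)
  have "truncated_shift r m e i \<in> bops" by (simp add: truncated_shift_def)
  then show ?case
    by (simp add: Cons bopsD truncated_shift_basis[OF e] blinfun.zero_right scaleC_scaleC scaleC.zero_right mult.commute)
qed (use assms(2) in \<open>simp add: scaleC_one\<close>)

text \<open>
  The quadratic form of \<open>P[L\<^sub>g]\<close> at a truncated shift (\<open>r < 1\<close>) and of \<open>L\<^sub>g\<close> itself (\<open>r = 1\<close>), at the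
  vector with coefficients \<open>v\<close> on \<open>F\<close>.
\<close>

definition toeplitz_form :: "'n::finite fock \<Rightarrow> nat \<Rightarrow> 'n list set \<Rightarrow> ('n list \<Rightarrow> complex) \<Rightarrow> real \<Rightarrow> complex" where
  "toeplitz_form g m F v r = (\<Sum>\<gamma> | length \<gamma> \<le> m. Rep_ell2 g \<gamma> *
    (of_real r ^ length \<gamma> * (\<Sum>\<beta>\<in>F. v \<beta> * (if \<gamma> @ \<beta> \<in> F then cnj (v (\<gamma> @ \<beta>)) else 0))))"

lemma tendsto_toeplitz_form: "(toeplitz_form g m F v \<longlongrightarrow> toeplitz_form g m F v 1) (at_left 1)"
  unfolding toeplitz_form_def[abs_def] by (intro tendsto_intros)

text \<open>Only products \<open>\<gamma> @ \<beta>\<close> lying in \<open>F\<close> contribute,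
  and these have length at most \<open>m\<close>; so the truncation is invisible and the series is a
  finite sum.\<close>

lemma poisson_truncated_shift:
  fixes e :: "'n::finite list \<Rightarrow> 'h::chilbert_space" and v :: "'n list \<Rightarrow> complex"
  assumes e: "orthonormal_on {\<alpha>. length \<alpha> \<le> m} e" and r: "0 < r" "r < 1"
    and F: "finite F" "F \<subseteq> {\<alpha>. length \<alpha> \<le> m}" and g: "g \<in> F_infinity"
  defines "x \<equiv> \<Sum>\<beta>\<in>F. v \<beta> *\<^sub>C e \<beta>"
  shows "cinner (blinfun_apply (poisson_transform (left_mult g) (truncated_shift r m e)) x) x = toeplitz_form g m F v r"
proof -
  let ?X = "truncated_shift r m e"
  note X = truncated_shift_row_ball[OF e r]
  have ex: "cinner (e \<delta>) x = (if \<delta> \<in> F then cnj (v \<delta>) else 0)" if "length \<delta> \<le> m" for \<delta>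
  proof -
    have "cinner (e \<delta>) x = (\<Sum>\<beta>\<in>F. if \<beta> = \<delta> then cnj (v \<beta>) else 0)"
      unfolding x_def cinner.sum_right cinner_scaleC_right
      using e F(2) that by (intro sum.cong) (auto simp: orthonormal_on_def subset_iff)
    then show ?thesis using F(1) by simp
  qed
  have form: "cinner (blinfun_apply (word_op ?X \<gamma>) x) x =
      of_real r ^ length \<gamma> * (\<Sum>\<beta>\<in>F. v \<beta> * (if \<gamma> @ \<beta> \<in> F then cnj (v (\<gamma> @ \<beta>)) else 0))" for \<gamma>
  proof -
    have "cinner (blinfun_apply (word_op ?X \<gamma>) x) x = (\<Sum>\<beta>\<in>F. v \<beta> * cinner (blinfun_apply (word_op ?X \<gamma>) (e \<beta>)) x)"
      by (subst x_def) (simp add: blinfun.sum_right bopsD bops_word_op row_ballD(1)[OF X] cinner.sum_left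
          cinner_scaleC_left)
    also have "\<dots> = (\<Sum>\<beta>\<in>F. of_real r ^ length \<gamma> * (v \<beta> * (if \<gamma> @ \<beta> \<in> F then cnj (v (\<gamma> @ \<beta>)) else 0)))"
    proof (rule sum.cong)
      fix \<beta> assume "\<beta> \<in> F"
      then have "length \<beta> \<le> m" using F(2) by auto
      \<comment> \<open>Beyond length \<open>m\<close> the shifted vector is 0, and the coefficient
        on the right is 0 as well.\<close>
      moreover have "\<gamma> @ \<beta> \<notin> F" if "\<not> length (\<gamma> @ \<beta>) \<le> m" using that F(2) by blast
      ultimately show "v \<beta> * cinner (blinfun_apply (word_op ?X \<gamma>) (e \<beta>)) x =
          of_real r ^ length \<gamma> * (v \<beta> * (if \<gamma> @ \<beta> \<in> F then cnj (v (\<gamma> @ \<beta>)) else 0))"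
        using ex[of "\<gamma> @ \<beta>"] by (auto simp: word_op_truncated_shift[OF e] cinner_scaleC_left cinner.zero_left)
    qed simp
    finally show ?thesis by (simp only: sum_distrib_left)
  qed
  have "((\<lambda>\<gamma>. Rep_ell2 g \<gamma> * cinner (blinfun_apply (word_op ?X \<gamma>) x) x) has_sum toeplitz_form g m F v r) UNIV"
  proof (rule has_sum_finite_neutralI[OF finite_words_le[of m]])
    fix \<gamma> :: "'n list" assume "\<gamma> \<in> UNIV - {\<alpha>. length \<alpha> \<le> m}"
    then have "\<gamma> @ \<beta> \<notin> F" for \<beta> using F(2) by auto
    then show "Rep_ell2 g \<gamma> * cinner (blinfun_apply (word_op ?X \<gamma>) x) x = 0" by (simp add: form)
  qed (simp_all add: toeplitz_form_def form)
  then show ?thesis using has_sum_poisson_left_mult[OF X g, of x x] has_sum_unique by blast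
qed

text \<open>The untruncated operator has the same finite sum with \<open>r = 1\<close>; this
  identifies the limit of the forms at truncated shifts.\<close>

lemma left_mult_form:
  fixes g :: "'n::finite fock" and v :: "'n list \<Rightarrow> complex"
  assumes F: "finite F" "F \<subseteq> {\<alpha>. length \<alpha> \<le> m}" and g: "g \<in> F_infinity"
  defines "x \<equiv> \<Sum>\<beta>\<in>F. fock_basis \<beta> \<otimes>\<^sub>2 v \<beta>"
  shows "cinner (blinfun_apply (left_mult g) x) x = toeplitz_form g m F v 1"
proof -
  have one: "y \<otimes>\<^sub>2 (c :: complex) = c *\<^sub>C y" for y :: "'n fock" and c
    by (rule ell2_eqI) (simp add: ell2_tensor.rep_eq scaleC_ell2.rep_eq scaleC_complex_def)
  have "cinner (blinfun_apply (left_mult g) (fock_basis \<beta>)) x =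
      (\<Sum>\<gamma> | length \<gamma> \<le> m. Rep_ell2 g \<gamma> * (if \<gamma> @ \<beta> \<in> F then cnj (v (\<gamma> @ \<beta>)) else 0))" for \<beta>
  proof (rule has_sum_unique)
    show "((\<lambda>\<alpha>. Rep_ell2 g \<alpha> * cinner 1 (Rep_ell2 x (\<alpha> @ \<beta>))) has_sum
        cinner (blinfun_apply (left_mult g) (fock_basis \<beta>)) x) UNIV"
      using has_sum_left_mult_basis[OF g, of 1 x \<beta>] by (simp add: one scaleC_one)
    show "((\<lambda>\<alpha>. Rep_ell2 g \<alpha> * cinner 1 (Rep_ell2 x (\<alpha> @ \<beta>))) has_sum
        (\<Sum>\<gamma> | length \<gamma> \<le> m. Rep_ell2 g \<gamma> * (if \<gamma> @ \<beta> \<in> F then cnj (v (\<gamma> @ \<beta>)) else 0))) UNIV"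
    proof (rule has_sum_finite_neutralI[OF finite_words_le[of m]])
      fix \<gamma> :: "'n list" assume "\<gamma> \<in> UNIV - {\<alpha>. length \<alpha> \<le> m}"
      then have "\<gamma> @ \<beta> \<notin> F" using F(2) by auto
      then show "Rep_ell2 g \<gamma> * cinner 1 (Rep_ell2 x (\<gamma> @ \<beta>)) = 0"
        by (simp add: x_def Rep_fock_partial_sum[OF F(1)] cinner_complex_def)
    qed (auto simp: x_def Rep_fock_partial_sum[OF F(1)] cinner_complex_def intro!: sum.cong)
  qed
  moreover have "cinner (blinfun_apply (left_mult g) x) x =
      (\<Sum>\<beta>\<in>F. v \<beta> * cinner (blinfun_apply (left_mult g) (fock_basis \<beta>)) x)"
    by (subst x_def) (simp add: one blinfun.sum_right bopsD[OF bops_left_mult[OF g]] cinner.sum_left cinner_scaleC_left)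
  ultimately show ?thesis
    by (simp only: toeplitz_form_def of_real_1 power_one mult_1_left sum_distrib_left)
       (subst sum.swap, simp only: mult.left_commute)
qed

section \<open>Positivity of the symbol from its Poisson transform\<close>

lemma cinner_adj_self:
  fixes T :: "'a::chilbert_space \<Rightarrow>\<^sub>L 'a"
  assumes "T \<in> bops"
  shows "cinner (blinfun_apply (adj T) x) x = cnj (cinner (blinfun_apply T x) x)"
  using cinner_adj_left[OF assms, of x x] cinner_commute[of x "blinfun_apply T x"] by simp

lemma positive_symbol:
  fixes g h :: "'n::finite fock"
  assumes inf: "infinite_dimensional TYPE('h::chilbert_space)"
    and h: "h \<in> F_infinity" and g: "g \<in> F_infinity"
    and pos: "\<And>X :: 'n \<Rightarrow> 'h \<Rightarrow>\<^sub>L 'h. X \<in> row_ball \<Longrightarrow>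
      positive_op (poisson_transform (adj (left_mult h) + left_mult g) X)"
  shows "positive_op (adj (left_mult h) + left_mult g)"
  unfolding positive_op_def
proof (intro conjI allI)
  show "adj (left_mult h) + left_mult g \<in> bops" using h g by simp
  fix x :: "'n fock"
  show "cinner (blinfun_apply (adj (left_mult h) + left_mult g) x) x \<in> \<real>\<^sub>\<ge>\<^sub>0"
  proof (rule positive_on_partial_sums)
    fix F :: "'n list set" assume F: "finite F"
    \<comment> \<open>The inserted 0 covers an empty \<open>F\<close>.\<close>
    define m where "m = Max (insert 0 (length ` F))"
    have Fm: "F \<subseteq> {\<alpha>. length \<alpha> \<le> m}" using F by (auto simp: m_def)
    obtain e :: "'n list \<Rightarrow> 'h" where e: "orthonormal_on {\<alpha>. length \<alpha> \<le> m} e"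
      using orthonormal_family_exists[OF inf finite_words_le[of m]] by blast
    let ?v = "Rep_ell2 x"
    define z where "z = (\<Sum>\<beta>\<in>F. ?v \<beta> *\<^sub>C e \<beta>)"
    \<comment> \<open>\<open>m\<close>, the family \<open>e\<close> and the vector \<open>z\<close>
      stay fixed while \<open>r\<close> varies, so the limit below concerns only the powers of
      \<open>r\<close>. The adjoint term of the symbol contributes the conjugate form.\<close>
    have "toeplitz_form g m F ?v r + cnj (toeplitz_form h m F ?v r) \<in> \<real>\<^sub>\<ge>\<^sub>0" if r: "0 < r" "r < 1" for r
    proof -
      note X = truncated_shift_row_ball[OF e r]
      have "cinner (blinfun_apply (poisson_transform (adj (left_mult h) + left_mult g) (truncated_shift r m e)) z) z =
          toeplitz_form g m F ?v r + cnj (toeplitz_form h m F ?v r)"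
        by (simp add: poisson_transform_add poisson_transform_adj[OF X] h g blinfun.add_left cinner_add_left
            cinner_adj_self bops_poisson_transform[OF X] z_def poisson_truncated_shift[OF e r F Fm])
      then show ?thesis using pos[OF X] unfolding positive_op_def by metis
    qed
    then have "\<forall>\<^sub>F r in at_left 1. toeplitz_form g m F ?v r + cnj (toeplitz_form h m F ?v r) \<in> \<real>\<^sub>\<ge>\<^sub>0"
      using eventually_at_left_real[of 0 1] by (auto elim: eventually_mono)
    then have "toeplitz_form g m F ?v 1 + cnj (toeplitz_form h m F ?v 1) \<in> \<real>\<^sub>\<ge>\<^sub>0"
      by (rule Lim_in_closed_set[OF closed_nonneg_Reals_complex])
         (intro tendsto_intros tendsto_toeplitz_form trivial_limit_at_left_real)+
    then show "cinner (blinfun_apply (adj (left_mult h) + left_mult g) (\<Sum>\<alpha>\<in>F. fock_basis \<alpha> \<otimes>\<^sub>2 ?v \<alpha>))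
        (\<Sum>\<alpha>\<in>F. fock_basis \<alpha> \<otimes>\<^sub>2 ?v \<alpha>) \<in> \<real>\<^sub>\<ge>\<^sub>0"
      by (simp add: blinfun.add_left cinner_add_left cinner_adj_self h g left_mult_form[OF F Fm] add.commute)
  qed
qed

theorem theorem6p3:
  fixes f :: "'n::finite fock \<Rightarrow>\<^sub>L 'n fock"
    and u :: "('n \<Rightarrow> 'h::chilbert_space \<Rightarrow>\<^sub>L 'h) \<Rightarrow> 'h \<Rightarrow>\<^sub>L 'h"
  assumes "f \<in> harmonic_symbols"
    and "u = poisson_transform f"
  shows "free_pluriharmonic u \<and>
    (infinite_dimensional TYPE('h) \<longrightarrow>
      ((\<forall>X\<in>row_ball. positive_op (u X)) \<longleftrightarrow> positive_op f))"
proof -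
  obtain h g where hg: "h \<in> F_infinity" "g \<in> F_infinity" and f: "f = adj (left_mult h) + left_mult g"
    using assms(1) by (auto simp: harmonic_symbols_def)
  have "f \<in> bops" using hg by (simp add: f)
  then have "positive_op (u X)" if "positive_op f" "X \<in> row_ball" for X
    unfolding positive_op_def assms(2)
    using that by (simp add: cinner_poisson_transform bops_poisson_transform tensor_id_op_nonneg)
  moreover have "positive_op f" if "infinite_dimensional TYPE('h)" "\<forall>X\<in>row_ball. positive_op (u X)"
    using positive_symbol[OF that(1) hg] that(2) by (auto simp: assms(2) f)
  moreover have "free_pluriharmonic u"
    unfolding assms(2) f by (rule free_pluriharmonic_poisson_transform[OF hg])
  ultimately show ?thesis by blast
qed

end
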